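(* Let $(x_n)_{n \geq 1}$ be a sequence of positive real numbers for which there exists $c>0$ such that $x_{n+1} - x_n \geq c$ for all $n \geq 1$. For $N \geq 1$ and $\gamma \in (0,1]$ let $E_{N,\gamma}^*$ denote the number of quadruples of positive integers $(n_1, n_2, n_3, n_4)$ with $n_i \leq N$ for $i=1,2,3,4$ and $$|x_{n_1} - x_{n_2} + x_{n_3} - x_{n_4}| < \gamma.$$ Assume that there exists some $\delta>0$ such that for all $\eta>0$ we have $$E_{N,\gamma}^* \ll_{\eta,\delta} N^{2 + \eta} + \gamma N^{3-\delta}$$ as $N \to \infty$, uniformly for $\gamma \in (0,1]$. Then the sequence $(x_n \alpha)_{n \geq 1}$ has Poissonian pair correlation for almost all $\alpha \in \mathbb{R}$ (with respect to Lebesgue measure).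
   Context: For $s \geq 0$ and $N\ge 1$, $\mathbf{1}_{[-s/N,s/N]}$ denotes the indicator function of $[-s/N,s/N]$ extended with period $1$, i.e. $\mathbf{1}_{[-s/N,s/N]}(x)=1$ if the signed difference between $x$ and its nearest integer lies in $[-s/N,s/N]$, and $0$ otherwise. A sequence $(y_n)_{n \geq 1}$ of real numbers has Poissonian pair correlation if for all real $s \geq 0$, $$\lim_{N \to \infty} \frac{1}{N} \sum_{\substack{1 \leq m,n \leq N,\\ m \neq n}} \mathbf{1}_{[-s/N,s/N]} (y_n - y_m) = 2 s.$$ *)

theory Defs
  imports "HOL-Analysis.Analysis"
begin

text \<open>
  Sequences \<open>(y\<^sub>n)\<close> with \<open>n \<ge> 1\<close> are functions on \<^typ>\<open>nat\<close> whose value at \<open>0\<close> is never used.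
\<close>

text \<open>
  The indicator function of \<open>[-r, r]\<close> extended with period 1. The term \<open>x - round x\<close> is the signed
  difference between \<open>x\<close> and its nearest integer; the choice made by \<^const>\<open>round\<close> for half-integers
  is irrelevant because the interval is symmetric.
\<close>

definition periodic_indicator :: "real \<Rightarrow> real \<Rightarrow> real" where
  "periodic_indicator r x = indicator {- r..r} (x - of_int (round x))"

definition poissonian_pair_correlation :: "(nat \<Rightarrow> real) \<Rightarrow> bool" where
  "poissonian_pair_correlation y \<longleftrightarrow>
     (\<forall>s\<ge>0. (\<lambda>N. 1 / real N *
         (\<Sum>(m, n) \<in> {(m, n). m \<in> {1..N} \<and> n \<in> {1..N} \<and> m \<noteq> n}.
            periodic_indicator (s / real N) (y n - y m)))
       \<longlonglongrightarrow> 2 * s)"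

definition energy :: "(nat \<Rightarrow> real) \<Rightarrow> nat \<Rightarrow> real \<Rightarrow> nat" where
  "energy x N \<gamma> = card {(n1, n2, n3, n4).
     n1 \<in> {1..N} \<and> n2 \<in> {1..N} \<and> n3 \<in> {1..N} \<and> n4 \<in> {1..N} \<and>
     \<bar>x n1 - x n2 + x n3 - x n4\<bar> < \<gamma>}"

end

theory Submission
  imports Defs "HOL-Probability.Probability" "HOL-Computational_Algebra.Computational_Algebra"
    "HOL-Real_Asymp.Real_Asymp"
begin

text \<open>
  Triangle functions have nonnegative, quadratically decaying Fourier coefficients, and every
  indicator of an interval is squeezed between difference quotients of triangles of rational width.
  It therefore suffices to control the pair statistic of a triangle of width \<open>a/N\<close> along the
  sequence \<open>N = k\<^sup>q\<close>, whose consecutive ratios tend to 1. Its variance, taken against the standard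
  Gaussian measure in \<open>\<alpha>\<close>, is bounded by counting, for dyadic \<open>J\<close>, the solutions of
  \<open>\<bar>j z - l z'\<bar> < 1\<close> with \<open>J \<le> j, l < 2J\<close>, where \<open>z, z'\<close> run through the differences
  \<open>x\<^sub>n - x\<^sub>m\<close>, \<open>m < n \<le> N\<close>. After taking logarithms this count is at most a constant times the mean
  of \<open>\<bar>Z P\<bar>\<^sup>2\<close>, where \<open>Z(t)\<close> is the sum of \<open>j\<^sup>i\<^sup>t\<close> and \<open>P(t)\<close> the sum of \<open>z\<^sup>i\<^sup>t\<close>. Cauchy--Schwarz with the
  energy hypothesis just fails to suffice. The power that is missing is gained by splitting at
  \<open>\<bar>Z\<bar> = K\<close>: for small \<open>Z\<close> the mean of \<open>\<bar>P\<bar>\<^sup>2\<close> is an energy with \<open>\<gamma> = 1/J\<close>, and for large \<open>Z\<close> one uses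
  \<open>\<bar>Z\<bar>\<^sup>2 \<le> K\<^sup>-\<^sup>4 \<bar>Z\<bar>\<^sup>6\<close> and the sixth moment of \<open>Z\<close>, which the divisor bound controls. What is lost
  there for short time intervals is recovered from the energy with \<open>\<gamma> = 1\<close>.
\<close>

subsection \<open>Fourier series of the triangle function\<close>

text \<open>Squared coefficients at frequencies j near N have size N^-4, while the statistic itself
  has size 1, so for J near N the number of coincidences must fall below N^4 by a power; a power is
  wanted because the variances are summed along k^q and carry logarithms. At J = N the bound |Z| <=
  J with the mean of |P|^2 gives N^(4+\<eta>), and |P| <= N^2 with Cauchy--Schwarz and the fourth
  moment of Z again ends at exponent 4. The sixth moment bounds the part with large Z by N^4 K^-4
  J^3 up to small powers, which at K^2 = N^2 is N^3. This spare factor N allows K^2 a power below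
  N^2, and that is what the part with small Z needs.

  The Gaussian serves twice, as the law of \<alpha> and as the weight in t. Its cosine transform is
  positive and decays fast, so mean squares of exponential sums with nonnegative weights bound
  coincidence counts from above and below. The length of the time interval is put into the phases,
  so the measure never changes.\<close>

definition dilog :: "complex \<Rightarrow> complex" where
  "dilog z = (\<Sum>n. z ^ Suc n / of_nat (Suc n) ^ 2)"

lemma summable_inverse_Suc_squares: "summable (\<lambda>n. 1 / real (Suc n) ^ 2)"
  using inverse_squares_sums by (auto simp: sums_iff)

lemma norm_dilog_term_le: "norm z \<le> 1 \<Longrightarrow> norm (z ^ Suc n / of_nat (Suc n) ^ 2 :: complex) \<le> 1 / real (Suc n) ^ 2"
  by (simp add: norm_divide norm_power power_le_one divide_right_mono norm_mult mult_le_one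
           del: of_nat_Suc)

lemma dilog_sums:
  assumes "norm z \<le> 1"
  shows "(\<lambda>n. z ^ Suc n / of_nat (Suc n) ^ 2) sums dilog z"
  unfolding dilog_def
  by (rule summable_sums, rule summable_comparison_test'[OF summable_inverse_Suc_squares, of 0])
     (rule norm_dilog_term_le[OF assms])

lemma continuous_on_dilog: "continuous_on (cball 0 1) dilog"
proof -
  have "uniform_limit (cball 0 1) (\<lambda>n z. \<Sum>i<n. z ^ Suc i / of_nat (Suc i) ^ 2 :: complex) dilog sequentially"
    unfolding dilog_def
    by (rule Weierstrass_m_test[OF _ summable_inverse_Suc_squares]) (rule norm_dilog_term_le, simp)
  then show ?thesis
    by (rule uniform_limit_theorem[rotated]) (auto intro!: always_eventually continuous_intros simp del: of_nat_Suc)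
qed

lemma sums_minus_Ln:
  assumes "norm (z::complex) < 1"
  shows "(\<lambda>n. z ^ Suc n / of_nat (Suc n)) sums - Ln (1 - z)"
proof -
  have "(\<lambda>n. (-1)^Suc n / of_nat n * (-z)^n) sums ln (1 + (-z))"
    using Ln_series[of "-z"] assms by simp
  then have "(\<lambda>n. - (z ^ n / of_nat n)) sums Ln (1 - z)"
    by (simp flip: power_mult_distrib)
  from sums_minus[OF this] have "(\<lambda>n. z ^ n / of_nat n) sums - Ln (1 - z)" by simp
  then show ?thesis
    by (subst sums_Suc_iff) simp
qed

text \<open>On the unit circle Re \<open>dilog\<close> is the series of cos(n t)/n^2. This
  derivative turns it into an integral of the argument of 1 - z, which is linear in the angle on the
  circle itself.\<close>

lemma dilog_has_field_derivative:
  assumes "norm z < 1" "z \<noteq> 0"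
  shows "(dilog has_field_derivative - Ln (1 - z) / z) (at z)"
proof -
  define c :: "nat \<Rightarrow> complex" where "c n = 1 / of_nat n ^ 2" for n
  have dil: "dilog w = (\<Sum>n. c n * w ^ n)" if "norm w < 1" for w
  proof -
    have "(\<lambda>n. c (Suc n) * w ^ Suc n) sums dilog w"
      using dilog_sums[of w] that by (simp add: c_def del: of_nat_Suc power_Suc)
    then have "(\<lambda>n. c n * w ^ n) sums dilog w"
      by (subst (asm) sums_Suc_iff) (simp add: c_def)
    then show ?thesis by (simp add: sums_iff)
  qed
  obtain r where r: "norm z < r" "r < 1" using assms dense by blast
  have "summable (\<lambda>n. c n * of_real r ^ n)"
  proof -
    have "norm (of_real r :: complex) \<le> 1" using r norm_ge_zero[of z] by (simp del: norm_ge_zero)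
    from dilog_sums[OF this] have "summable (\<lambda>n. c (Suc n) * of_real r ^ Suc n)"
      by (simp add: c_def sums_iff del: of_nat_Suc power_Suc)
    then show ?thesis by (subst (asm) summable_Suc_iff)
  qed
  then have D: "((\<lambda>w. \<Sum>n. c n * w ^ n) has_field_derivative (\<Sum>n. diffs c n * z ^ n)) (at z)"
    by (rule termdiffs_strong) (use r norm_ge_zero[of z] in \<open>simp del: norm_ge_zero\<close>)
  have "(\<lambda>n. z * (diffs c n * z ^ n)) sums - Ln (1 - z)"
  proof -
    have "z * (diffs c n * z ^ n) = z ^ Suc n / of_nat (Suc n)" for n
      by (simp add: diffs_def c_def power2_eq_square field_simps del: of_nat_Suc)
    then show ?thesis using sums_minus_Ln[OF assms(1)] by simp
  qed
  from sums_divide[OF this, of z] have "(\<Sum>n. diffs c n * z ^ n) = - Ln (1 - z) / z"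
    using assms(2) by (simp add: sums_iff)
  with D have "((\<lambda>w. \<Sum>n. c n * w ^ n) has_field_derivative - Ln (1 - z) / z) (at z)" by simp
  then show ?thesis
    by (rule has_field_derivative_transform_within_open[where S = "ball 0 1"])
       (use assms(1) in \<open>simp_all only: dist_norm mem_ball open_ball dil diff_0 norm_minus_cancel\<close>)
qed

text \<open>The factorisation 1 - e^(it) = 2 sin(t/2) e^(i(t - pi)/2) has a positive first factor
  and an angle between -pi/2 and pi/2, so the principal argument can be read off.\<close>

lemma Im_Ln_one_minus_cis:
  assumes "0 < t" "t < 2 * pi"
  shows "Im (Ln (1 - cis t)) = (t - pi) / 2"
proof -
  have "1 - cis t = complex_of_real (2 * sin (t/2)) * cis ((t - pi) / 2)"
  proof -
    have e: "t/2 - pi/2 = - (pi/2 - t/2)" by simp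
    have "cos ((t-pi)/2) = sin (t/2)" "sin ((t-pi)/2) = - cos (t/2)"
      unfolding diff_divide_distrib e cos_minus sin_minus
      by (simp_all add: cos_diff sin_diff)
    moreover have "cos t = 1 - 2 * sin (t/2)^2" "sin t = 2 * sin (t/2) * cos (t/2)"
      using cos_double_sin[of "t/2"] sin_double[of "t/2"] by simp_all
    ultimately show ?thesis
      by (simp add: complex_eq_iff power2_eq_square del: of_real_mult)
  qed
  moreover have "sin (t/2) > 0" using assms by (intro sin_gt_zero) auto
  ultimately have "Ln (1 - cis t) = of_real (ln (2 * sin (t/2))) + Ln (cis ((t - pi) / 2))"
    by (simp add: Ln_times_of_real Ln_of_real del: of_real_mult of_real_divide of_real_diff)
  also have "Ln (cis ((t - pi) / 2)) = \<i> * of_real ((t - pi) / 2)"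
    unfolding cis_conv_exp using assms by (intro Ln_exp) auto
  finally show ?thesis by simp
qed

text \<open>On a circle of radius r < 1 the angular derivative of Re \<open>dilog\<close> is Im Ln(1
  - r e^(it)). Letting r tend to 1, dominated convergence with |Im Ln| <= pi treats the integral,
  and continuity of \<open>dilog\<close> on the closed disc treats the end points.\<close>

lemma Re_dilog_cis_diff:
  assumes "0 < a" "a \<le> b" "b < 2 * pi"
  shows "Re (dilog (cis b)) - Re (dilog (cis a)) = (b - pi)^2 / 4 - (a - pi)^2 / 4"
proof -
  define r where "r n = 1 - 1 / real (n + 2)" for n
  have r: "0 < r n" "r n < 1" for n by (auto simp: r_def field_simps)
  have rlim: "r \<longlonglongrightarrow> 1"
    unfolding r_def by real_asymp
  define f where "f n t = Im (Ln (1 - of_real (r n) * cis t))" for n t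
  have der: "((\<lambda>t. Re (dilog (of_real (r n) * cis t))) has_real_derivative f n t) (at t within S)" for n t S
  proof -
    have nz: "norm (of_real (r n) * cis t) < 1" "of_real (r n) * cis t \<noteq> 0"
      using r[of n] by (auto simp: norm_mult)
    have "((\<lambda>t. of_real (r n) * cis t) has_vector_derivative of_real (r n) * (\<i> * cis t)) (at t within S)"
      unfolding cis_conv_exp
      by (auto intro!: derivative_eq_intros has_vector_derivative_real_field)
    from field_vector_diff_chain_within[OF this has_field_derivative_at_within[OF dilog_has_field_derivative[OF nz]]]
    have "((\<lambda>t. dilog (of_real (r n) * cis t)) has_vector_derivative (- \<i> * Ln (1 - of_real (r n) * cis t))) (at t within S)"
      using nz by (simp add: o_def field_simps)
    from bounded_linear.has_vector_derivative[OF bounded_linear_Re this]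
    show ?thesis by (simp add: f_def has_real_derivative_iff_has_vector_derivative)
  qed
  have int: "(f n has_integral (Re (dilog (of_real (r n) * cis b)) - Re (dilog (of_real (r n) * cis a)))) {a..b}" for n
    by (rule fundamental_theorem_of_calculus[OF assms(2)])
       (use der in \<open>simp add: has_real_derivative_iff_has_vector_derivative\<close>)
  have lim: "(\<lambda>n. f n t) \<longlonglongrightarrow> (t - pi) / 2" if "t \<in> {a..b}" for t
  proof -
    have "Im (Ln (1 - cis t)) = (t - pi) / 2" using that assms by (intro Im_Ln_one_minus_cis) auto
    moreover have nonpos: "(1 - cis t) \<notin> \<real>\<^sub>\<le>\<^sub>0"
    proof -
      have "cos t < 1"
      proof (rule ccontr)
        assume "\<not> cos t < 1"
        then have "cos t = 1" using cos_le_one[of t] by linarith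
        then obtain k :: int where k: "t = k * 2 * pi" by (auto simp: cos_one_2pi_int)
        have "0 < t" "t < 2 * pi" using that assms by auto
        with k have "0 < real_of_int k * (2 * pi)" "real_of_int k * (2 * pi) < 1 * (2 * pi)" by auto
        then have "0 < real_of_int k" "real_of_int k < 1"
          unfolding mult_less_cancel_right zero_less_mult_iff using pi_gt_zero by auto
        then show False by simp
      qed
      then show ?thesis by (auto simp: complex_nonpos_Reals_iff)
    qed
    moreover have "(\<lambda>n. 1 - of_real (r n) * cis t) \<longlonglongrightarrow> 1 - of_real 1 * cis t"
      by (intro tendsto_intros rlim)
    then have "(\<lambda>n. Im (Ln (1 - of_real (r n) * cis t))) \<longlonglongrightarrow> Im (Ln (1 - cis t))"
      by (intro tendsto_Im tendsto_Ln) (use nonpos in auto)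
    ultimately show ?thesis unfolding f_def by (simp only:)
  qed
  have bd: "norm (f n t) \<le> pi" for n t
  proof -
    have "1 - of_real (r n) * cis t \<noteq> 0"
    proof
      assume "1 - of_real (r n) * cis t = 0"
      then have "norm (of_real (r n) * cis t) = norm (1::complex)" by simp
      then show False using r[of n] by (simp add: norm_mult)
    qed
    then show ?thesis
      using Im_Ln_le_pi[of "1 - of_real (r n) * cis t"] mpi_less_Im_Ln[of "1 - of_real (r n) * cis t"]
      by (auto simp: f_def abs_if)
  qed
  have "(\<lambda>n. integral {a..b} (f n)) \<longlonglongrightarrow> integral {a..b} (\<lambda>t. (t - pi) / 2)"
    by (rule dominated_convergence(2)[where h = "\<lambda>_. pi"]) (use int bd lim in auto)
  also have "integral {a..b} (\<lambda>t. (t - pi) / 2) = (b - pi)^2 / 4 - (a - pi)^2 / 4"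
    by (rule integral_unique, rule fundamental_theorem_of_calculus[OF assms(2)])
       (auto intro!: derivative_eq_intros simp: has_real_derivative_iff_has_vector_derivative[symmetric])
  finally have "(\<lambda>n. Re (dilog (of_real (r n) * cis b)) - Re (dilog (of_real (r n) * cis a)))
      \<longlonglongrightarrow> (b - pi)^2 / 4 - (a - pi)^2 / 4"
    unfolding integral_unique[OF int] .
  moreover have "(\<lambda>n. of_real (r n) * cis t) \<longlonglongrightarrow> of_real 1 * cis t" for t
    by (intro tendsto_intros rlim)
  then have "(\<lambda>n. dilog (of_real (r n) * cis t)) \<longlonglongrightarrow> dilog (of_real 1 * cis t)" for t
    by (rule continuous_on_tendsto_compose[OF continuous_on_dilog])
       (use r in \<open>auto intro!: always_eventually less_imp_le simp: norm_mult abs_of_pos\<close>)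
  then have "(\<lambda>n. Re (dilog (of_real (r n) * cis b)) - Re (dilog (of_real (r n) * cis a)))
      \<longlonglongrightarrow> Re (dilog (cis b)) - Re (dilog (cis a))"
    by (intro tendsto_diff tendsto_Re) (simp_all add: tendsto_Re)
  ultimately show ?thesis by (rule LIMSEQ_unique[rotated])
qed

text \<open>The angles 0 and 2 pi, where Ln(1 - z) is singular, are reached by continuity. The value
  at pi stays unevaluated because it cancels in the second difference below.\<close>

lemma Re_dilog_cis:
  assumes "0 \<le> t" "t \<le> 2 * pi"
  shows "Re (dilog (cis t)) = (t - pi)^2 / 4 + Re (dilog (cis pi))"
proof -
  define g where "g t = Re (dilog (cis t)) - (t - pi)^2 / 4" for t
  have cont: "continuous_on {0..2*pi} g"
    unfolding g_def
    by (intro continuous_intros continuous_on_compose2[OF continuous_on_dilog]) auto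
  have const: "g t = g pi" if "t \<in> {0<..<2*pi}" for t
    using that Re_dilog_cis_diff[of t pi] Re_dilog_cis_diff[of pi t] 
    by (cases "t \<le> pi") (auto simp: g_def)
  have cl: "closure {0<..<2*pi} = {0..2*pi}" by (simp add: closure_greaterThanLessThan)
  have "g t = g pi"
    by (rule continuous_constant_on_closure[of "{0<..<2*pi}" g "g pi" t], unfold cl)
       (rule cont, erule const, use assms in simp)
  then show ?thesis by (simp add: g_def)
qed

lemma cos_squares_sums:
  assumes "0 \<le> u" "u \<le> 1"
  shows "(\<lambda>n. cos (2 * pi * real (Suc n) * u) / (pi * real (Suc n))^2) sums 
           (u^2 - u + (1/4 + Re (dilog (cis pi)) / pi^2))"
proof -
  have "(\<lambda>n. Re (cis (2 * pi * u) ^ Suc n / of_nat (Suc n) ^ 2)) sums Re (dilog (cis (2 * pi * u)))"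
    by (intro sums_Re dilog_sums) auto
  also have "(\<lambda>n. Re (cis (2 * pi * u) ^ Suc n / of_nat (Suc n) ^ 2)) =
      (\<lambda>n. cos (2 * pi * real (Suc n) * u) / (real (Suc n))^2)"
  proof
    fix n
    have "cis (2 * pi * u) ^ Suc n = cis (2 * pi * real (Suc n) * u)"
      unfolding Complex.DeMoivre by (simp only: mult_ac)
    then show "Re (cis (2 * pi * u) ^ Suc n / of_nat (Suc n) ^ 2) =
        cos (2 * pi * real (Suc n) * u) / (real (Suc n))^2"
      by (simp add: Re_divide_of_nat del: of_nat_Suc power_Suc flip: of_nat_power)
  qed
  also have "Re (dilog (cis (2 * pi * u))) = (2 * pi * u - pi)^2 / 4 + Re (dilog (cis pi))"
    using assms by (intro Re_dilog_cis) (auto simp: field_simps)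
  finally have "(\<lambda>n. cos (2 * pi * real (Suc n) * u) / (real (Suc n))^2 / pi^2) sums
      (((2 * pi * u - pi)^2 / 4 + Re (dilog (cis pi))) / pi^2)"
    by (rule sums_divide)
  moreover have "((2 * pi * u - pi)^2 / 4 + Re (dilog (cis pi))) / pi^2 = 
      u^2 - u + (1/4 + Re (dilog (cis pi)) / pi^2)"
    by (simp add: field_simps power2_eq_square)
  moreover have "cos (2 * pi * real (Suc n) * u) / (real (Suc n))^2 / pi^2 = 
      cos (2 * pi * real (Suc n) * u) / (pi * real (Suc n))^2" for n
    by (simp add: power_mult_distrib del: of_nat_Suc)
  ultimately show ?thesis by (simp only:)
qed

definition dist_int :: "real \<Rightarrow> real" where
  "dist_int t = \<bar>t - of_int (round t)\<bar>"

lemma dist_int_bounds: "0 \<le> dist_int t" "dist_int t \<le> 1/2"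
  using of_int_round_abs_le[of t] by (auto simp: dist_int_def abs_minus_commute)

lemma cos_mult_abs: "cos (a * \<bar>b\<bar>) = cos (a * b :: real)"
  by (cases "b < 0") simp_all

lemma cos_dist_int: "cos (2 * pi * real n * dist_int t) = cos (2 * pi * real n * t)"
proof -
  have "cos (2 * pi * real n * dist_int t) = cos (2 * pi * real n * (t - of_int (round t)))"
    unfolding dist_int_def cos_mult_abs ..
  also have "2 * pi * real n * (t - of_int (round t)) = 2 * pi * real n * t - 2 * pi * of_int (int n * round t)"
    by (simp add: algebra_simps)
  also have "cos \<dots> = cos (2 * pi * real n * t)"
    by (simp add: cos_diff cos_int_2pin sin_int_2pin del: of_int_mult)
  finally show ?thesis .
qed

text \<open>Up to the constant b^2, the triangle is -1/2 times the second difference with step b of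
  u^2 - u, with |d - b| in place of d - b. The additive constant drops out, and the same difference
  applied to a cosine yields the nonnegative factor 2 sin^2. The bound b <= 1/2 keeps d + b within
  [0,1], where the quadratic formula holds.\<close>

lemma triangle_fourier_sums:
  assumes "0 \<le> b" "b \<le> 1/2"
  shows "(\<lambda>n. 2 * (sin (pi * b * real (Suc n)) / (pi * real (Suc n)))^2 * cos (2 * pi * real (Suc n) * t))
           sums (max 0 (b - dist_int t) - b^2)"
proof -
  define d where "d = dist_int t"
  have d: "0 \<le> d" "d \<le> 1/2" using dist_int_bounds by (auto simp: d_def)
  define K where "K = 1/4 + Re (dilog (cis pi)) / pi^2"
  define C where "C n u = cos (2 * pi * real (Suc n) * u) / (pi * real (Suc n))^2" for n u
  have C: "(\<lambda>n. C n u) sums (u^2 - u + K)" if "0 \<le> u" "u \<le> 1" for u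
    unfolding C_def K_def by (rule cos_squares_sums[OF that])
  have "(\<lambda>n. C n d - 1/2 * C n (d + b) - 1/2 * C n \<bar>d - b\<bar>) sums
     ((d^2 - d + K) - 1/2 * ((d+b)^2 - (d+b) + K) - 1/2 * (\<bar>d-b\<bar>^2 - \<bar>d-b\<bar> + K))"
    by (intro sums_diff sums_mult C) (use d assms in auto)
  also have "((d^2 - d + K) - 1/2 * ((d+b)^2 - (d+b) + K) - 1/2 * (\<bar>d-b\<bar>^2 - \<bar>d-b\<bar> + K)) = max 0 (b - d) - b^2"
    by (cases "d \<le> b") (auto simp: max_def power2_eq_square field_simps)
  also have "(\<lambda>n. C n d - 1/2 * C n (d + b) - 1/2 * C n \<bar>d - b\<bar>) =
     (\<lambda>n. 2 * (sin (pi * b * real (Suc n)) / (pi * real (Suc n)))^2 * cos (2 * pi * real (Suc n) * t))"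
  proof
    fix n
    define p q where "p = 2 * pi * real (Suc n) * d" and "q = pi * b * real (Suc n)"
    have 1: "C n \<bar>d - b\<bar> = C n (d - b)"
      unfolding C_def cos_mult_abs ..
    have e: "2 * pi * real (Suc n) * (d + b) = p + 2 * q" "2 * pi * real (Suc n) * (d - b) = p - 2 * q"
      by (simp_all add: p_def q_def algebra_simps)
    have "cos p - 1/2 * cos (p + 2*q) - 1/2 * cos (p - 2*q) = 2 * sin q ^ 2 * cos p"
      unfolding cos_add cos_diff cos_double_sin by (simp add: algebra_simps)
    moreover have "C n d - 1/2 * C n (d + b) - 1/2 * C n (d - b) =
        (cos p - 1/2 * cos (p + 2*q) - 1/2 * cos (p - 2*q)) / (pi * real (Suc n))^2"
      unfolding C_def e p_def[symmetric] by (simp only: diff_divide_distrib times_divide_eq_right)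
    moreover have "cos p = cos (2 * pi * real (Suc n) * t)"
      unfolding p_def d_def by (rule cos_dist_int)
    ultimately show "C n d - 1/2 * C n (d + b) - 1/2 * C n \<bar>d - b\<bar> =
        2 * (sin (pi * b * real (Suc n)) / (pi * real (Suc n)))^2 * cos (2 * pi * real (Suc n) * t)"
      unfolding 1 q_def power_divide by (simp del: of_nat_Suc)
  qed
  finally show ?thesis by (simp add: d_def)
qed

subsection \<open>The divisor bound and Gaussian means of exponential sums\<close>

lemma card_divisors_primepow_mult_le:
  fixes p m a :: nat
  assumes "prime p" "m > 0"
  shows "card {d. d dvd p ^ a * m} \<le> (a + 1) * card {d. d dvd m}"
proof -
  have fin: "finite {d. d dvd m}" using assms by simp
  have "{d. d dvd p ^ a * m} \<subseteq> (\<lambda>(i, e). p ^ i * e) ` ({0..a} \<times> {d. d dvd m})"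
  proof
    fix d assume "d \<in> {d. d dvd p ^ a * m}"
    then obtain u v where uv: "d = u * v" "u dvd p ^ a" "v dvd m"
      using division_decomp[of d "p ^ a" m] by auto
    then obtain i where "i \<le> a" "u = p ^ i"
      using divides_primepow_nat[OF assms(1)] by blast
    then show "d \<in> (\<lambda>(i, e). p ^ i * e) ` ({0..a} \<times> {d. d dvd m})"
      using uv by (auto intro!: image_eqI[of _ _ "(i, v)"])
  qed
  then have "card {d. d dvd p ^ a * m} \<le> card ((\<lambda>(i, e). p ^ i * e) ` ({0..a} \<times> {d. d dvd m}))"
    using fin by (intro card_mono) auto
  also have "\<dots> \<le> card ({0..a} \<times> {d. d dvd m})"
    using fin by (intro card_image_le) auto
  finally show ?thesis by (simp add: card_cartesian_product)
qed

text \<open>Strip off the full power p^a of one prime at a time, at the cost of a factor a + 1. For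
  p >= 2^(1/\<epsilon>) this is at most p^(a \<epsilon>); a smaller prime costs an extra factor
  \<open>K\<close>, and fewer than \<open>P\<close> primes are that small.\<close>

lemma divisor_bound:
  assumes "\<epsilon> > 0"
  shows "\<exists>C\<ge>1. \<forall>n\<ge>1. real (card {d. d dvd n}) \<le> C * real n powr \<epsilon>"
proof -
  define P where "P = nat \<lceil>2 powr (1 / \<epsilon>)\<rceil>"
  define K where "K = 1 + 1 / (\<epsilon> * ln 2)"
  define S where "S n = {p \<in> prime_factors n. p < P}" for n :: nat
  have K1: "K \<ge> 1" using assms by (simp add: K_def)
  have big: "real a + 1 \<le> real p powr (real a * \<epsilon>)" if "p \<ge> P" for p a
  proof -
    have "2 powr (1/\<epsilon>) \<le> real p" using that unfolding P_def by linarith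
    then have "(2 powr (1/\<epsilon>)) powr (real a * \<epsilon>) \<le> real p powr (real a * \<epsilon>)"
      using assms by (intro powr_mono2) auto
    moreover have "(2 powr (1/\<epsilon>)) powr (real a * \<epsilon>) = 2 ^ a"
      using assms by (simp add: powr_powr powr_realpow)
    moreover have "real a + 1 \<le> 2 ^ a"
      using Bernoulli_inequality[of "1::real" a] by simp
    ultimately show ?thesis by linarith
  qed
  have small: "real a + 1 \<le> K * real p powr (real a * \<epsilon>)" if "p \<ge> 2" for p a :: nat
  proof -
    have "1 + real a * \<epsilon> * ln 2 \<le> exp (real a * \<epsilon> * ln 2)" by (rule exp_ge_add_one_self)
    also have "\<dots> = 2 powr (real a * \<epsilon>)" by (simp add: powr_def)
    also have "\<dots> \<le> real p powr (real a * \<epsilon>)" using that assms by (intro powr_mono2) auto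
    finally have *: "K * (1 + real a * \<epsilon> * ln 2) \<le> K * real p powr (real a * \<epsilon>)"
      using K1 by (intro mult_left_mono) auto
    have "K * (1 + real a * \<epsilon> * ln 2) = real a + 1 + real a * \<epsilon> * ln 2 + 1 / (\<epsilon> * ln 2)"
      using assms by (simp add: K_def field_simps)
    also have "\<dots> \<ge> real a + 1" using assms by simp
    finally show ?thesis using * by linarith
  qed
  have main: "real (card {d. d dvd n}) \<le> K ^ card (S n) * real n powr \<epsilon>" if "n \<ge> 1" for n
    using that
  proof (induction n rule: less_induct)
    case (less n)
    show ?case
    proof (cases "n = 1")
      case True
      then show ?thesis by (simp add: S_def)
    next
      case False
      then obtain p where p: "prime p" "p dvd n" using prime_factor_nat by blast
      have p2: "p \<ge> 2" using p prime_ge_2_nat by blast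
      define a where "a = multiplicity p n"
      have "n \<noteq> 0" "\<not> is_unit p" using less.prems p by auto
      then obtain m where m: "n = p ^ a * m" "\<not> p dvd m"
        using multiplicity_decompose'[of n p] unfolding a_def by blast
      have m0: "m \<ge> 1" using m(1) less.prems by (cases m) auto
      have a0: "a > 0" unfolding a_def using p less.prems by (subst multiplicity_gt_zero_iff) auto
      have "p ^ a > 1" using a0 p2 by (intro one_less_power) auto
      then have "m < n" using m(1) m0 by simp
      then have IH: "real (card {d. d dvd m}) \<le> K ^ card (S m) * real m powr \<epsilon>"
        using less.IH m0 by blast
      have pf: "S m \<subseteq> S n" "p \<notin> S m"
        using m dvd_prime_factors[OF \<open>n \<noteq> 0\<close>, of m] by (auto simp: S_def in_prime_factors_iff)
      have finS: "finite (S n)" "finite (S m)" by (auto simp: S_def)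
      have "card {d. d dvd n} \<le> (a + 1) * card {d. d dvd m}"
        unfolding m(1) by (rule card_divisors_primepow_mult_le[OF p(1)]) (use m0 in simp)
      then have "real (card {d. d dvd n}) \<le> real ((a + 1) * card {d. d dvd m})"
        by (simp only: of_nat_le_iff)
      then have "real (card {d. d dvd n}) \<le> (real a + 1) * real (card {d. d dvd m})"
        by (simp add: algebra_simps)
      also have "\<dots> \<le> (real a + 1) * (K ^ card (S m) * real m powr \<epsilon>)"
        using IH by (intro mult_left_mono) auto
      also have "\<dots> \<le> (K ^ (card (S n) - card (S m)) * real p powr (real a * \<epsilon>)) * (K ^ card (S m) * real m powr \<epsilon>)"
      proof (rule mult_right_mono)
        show "real a + 1 \<le> K ^ (card (S n) - card (S m)) * real p powr (real a * \<epsilon>)"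
        proof (cases "p < P")
          case True
          then have "p \<in> S n" using p less.prems by (auto simp: S_def prime_factors_dvd)
          then have "card (S m) < card (S n)" using pf finS by (intro psubset_card_mono) auto
          then have "K ^ 1 \<le> K ^ (card (S n) - card (S m))" using K1 by (intro power_increasing) auto
          then have "K * real p powr (real a * \<epsilon>) \<le> K ^ (card (S n) - card (S m)) * real p powr (real a * \<epsilon>)"
            by (intro mult_right_mono) auto
          then show ?thesis using small[OF p2, of a] by linarith
        next
          case False
          have "1 * real p powr (real a * \<epsilon>) \<le> K ^ (card (S n) - card (S m)) * real p powr (real a * \<epsilon>)"
            using K1 by (intro mult_right_mono) auto
          then show ?thesis using big[of p a] False by linarith
        qed
      qed (use K1 in auto)
      also have "\<dots> = (K ^ (card (S n) - card (S m)) * K ^ card (S m)) * (real p powr (real a * \<epsilon>) * real m powr \<epsilon>)"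
        by (simp add: mult_ac)
      also have "K ^ (card (S n) - card (S m)) * K ^ card (S m) = K ^ card (S n)"
        using pf finS by (simp add: power_add[symmetric] card_mono)
      also have "real p powr (real a * \<epsilon>) * real m powr \<epsilon> = real n powr \<epsilon>"
        using p2 by (simp add: m(1) powr_mult powr_powr[symmetric] powr_realpow)
      finally show ?thesis .
    qed
  qed
  have "real (card {d. d dvd n}) \<le> K ^ P * real n powr \<epsilon>" if "n \<ge> 1" for n
  proof -
    have "card (S n) \<le> card {..<P}" by (intro card_mono) (auto simp: S_def)
    then have "K ^ card (S n) * real n powr \<epsilon> \<le> K ^ P * real n powr \<epsilon>"
      using K1 by (intro mult_right_mono power_increasing) auto
    then show ?thesis using main[OF that] by linarith
  qed
  moreover have "K ^ P \<ge> 1" using K1 by simp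
  ultimately show ?thesis by blast
qed

section \<open>Mean squares of exponential sums against counts of close frequencies\<close>

abbreviation gauss :: "real \<Rightarrow> real" where
  "gauss u \<equiv> exp (- u\<^sup>2 / 2)"

text \<open>Frequencies are attached to indices rather than collected in a set: equal frequencies
  then count with multiplicity, and a product of two such sums is again one, over the product of the
  index sets.\<close>

definition expsum :: "'a set \<Rightarrow> ('a \<Rightarrow> real) \<Rightarrow> ('a \<Rightarrow> real) \<Rightarrow> real \<Rightarrow> complex" where
  "expsum A v p t = (\<Sum>i\<in>A. of_real (v i) * cis (p i * t))"

lemma norm_expsum_square:
  "(norm (expsum A v p t))\<^sup>2 = (\<Sum>i\<in>A. \<Sum>j\<in>A. v i * v j * cos ((p i - p j) * t))"
proof -
  have "complex_of_real ((norm (expsum A v p t))\<^sup>2) = expsum A v p t * cnj (expsum A v p t)"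
    by (rule complex_norm_square)
  also have "\<dots> = (\<Sum>i\<in>A. \<Sum>j\<in>A. of_real (v i * v j) * cis ((p i - p j) * t))"
    unfolding expsum_def cnj_sum sum_product
    by (intro sum.cong refl) (simp add: cis_cnj cis_mult algebra_simps)
  finally have "Re (complex_of_real ((norm (expsum A v p t))\<^sup>2)) = Re \<dots>" by (rule arg_cong)
  then show ?thesis by simp
qed

lemma integrable_std_normal_bounded:
  fixes f :: "real \<Rightarrow> real"
  assumes "continuous_on UNIV f" "\<And>t. \<bar>f t\<bar> \<le> B"
  shows "integrable std_normal_distribution f"
proof -
  interpret real_distribution std_normal_distribution by (rule real_dist_normal_dist)
  show ?thesis
    using assms by (intro integrable_const_bound[where B = B])
      (auto intro!: borel_measurable_continuous_onI)
qed

lemma integral_cos_std_normal: "(\<integral>t. cos (u * t) \<partial>std_normal_distribution) = gauss u"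
proof -
  interpret real_distribution std_normal_distribution by (rule real_dist_normal_dist)
  have "gauss u = Re (char std_normal_distribution u)"
    by (simp add: char_std_normal_distribution)
  also have "\<dots> = (\<integral>t. Re (iexp (u * t)) \<partial>std_normal_distribution)"
    unfolding char_def
    by (rule integral_Re[symmetric], rule integrable_iexp) auto
  also have "\<dots> = (\<integral>t. cos (u * t) \<partial>std_normal_distribution)"
    by (simp add: cis_conv_exp[symmetric] flip: of_real_mult)
  finally show ?thesis by simp
qed

lemma norm_expsum_le: "(\<And>i. i \<in> A \<Longrightarrow> v i \<ge> 0) \<Longrightarrow> norm (expsum A v p t) \<le> (\<Sum>i\<in>A. v i)"
  unfolding expsum_def by (rule order_trans[OF norm_sum]) (auto simp: norm_mult intro!: sum_mono)

lemma continuous_on_expsum [continuous_intros]: "continuous_on S (expsum A v p)"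
  unfolding expsum_def by (intro continuous_intros)

lemma integrable_norm_expsum_power:
  assumes "\<And>i. i \<in> A \<Longrightarrow> v i \<ge> 0"
  shows "integrable std_normal_distribution (\<lambda>t. norm (expsum A v p t) ^ n)"
  by (rule integrable_std_normal_bounded[where B = "(\<Sum>i\<in>A. v i) ^ n"])
     (auto intro!: continuous_intros power_mono norm_expsum_le assms)

lemma integral_norm_expsum_square:
  "(\<integral>t. (norm (expsum A v p t))\<^sup>2 \<partial>std_normal_distribution) =
     (\<Sum>i\<in>A. \<Sum>j\<in>A. v i * v j * gauss (p i - p j))"
proof -
  have int: "integrable std_normal_distribution (\<lambda>t. cos (u * t))" for u
    by (rule integrable_std_normal_bounded[where B = 1]) (auto intro!: continuous_intros)
  show ?thesis
    unfolding norm_expsum_square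
    by (simp add: Bochner_Integration.integral_sum int integral_cos_std_normal integrable_mult_right)
qed

lemma card_pairs_eq_sum:
  assumes "finite A"
  shows "card {(i, j). i \<in> A \<and> j \<in> A \<and> k i = f (k j)} =
           (\<Sum>\<kappa>\<in>k ` A. card {i\<in>A. k i = f \<kappa>} * card {i\<in>A. k i = \<kappa>})"
proof -
  have "{(i, j). i \<in> A \<and> j \<in> A \<and> k i = f (k j)} =
      (\<Union>\<kappa>\<in>k ` A. {i\<in>A. k i = f \<kappa>} \<times> {i\<in>A. k i = \<kappa>})" by auto
  also have "card \<dots> = (\<Sum>\<kappa>\<in>k ` A. card ({i\<in>A. k i = f \<kappa>} \<times> {i\<in>A. k i = \<kappa>}))"
    using assms by (intro card_UN_disjoint) auto
  finally show ?thesis by (simp add: card_cartesian_product)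
qed

text \<open>Cauchy--Schwarz over the fibres of \<open>k\<close>.\<close>

lemma card_square_le_card_pairs:
  assumes "finite A"
  shows "(real (card A))\<^sup>2 \<le> real (card (k ` A)) * real (card {(i, j). i \<in> A \<and> j \<in> A \<and> k i = k j})"
proof -
  have "card A = (\<Sum>\<kappa>\<in>k ` A. card {i\<in>A. k i = \<kappa>})"
    using sum.group[OF assms finite_imageI[OF assms] order_refl, of "\<lambda>_. 1 :: nat" k] by simp
  then have "(real (card A))\<^sup>2 = (\<Sum>\<kappa>\<in>k ` A. real (card {i\<in>A. k i = \<kappa>}))\<^sup>2" by simp
  also have "\<dots> \<le> (\<Sum>\<kappa>\<in>k ` A. (real (card {i\<in>A. k i = \<kappa>}))\<^sup>2) * real (card (k ` A))"
    by (rule sum_squared_le_sum_of_squares)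
  also have "(\<Sum>\<kappa>\<in>k ` A. (real (card {i\<in>A. k i = \<kappa>}))\<^sup>2) = 
      real (card {(i, j). i \<in> A \<and> j \<in> A \<and> k i = k j})"
    using card_pairs_eq_sum[OF assms, of k "\<lambda>x. x"] by (simp add: power2_eq_square)
  finally show ?thesis by (simp add: mult.commute)
qed

text \<open>An autocorrelation is largest at shift 0: with n \<kappa> the fibre sizes, n(\<kappa> +
  h) n(\<kappa>) is at most the mean of the two squares. Pairs in distant unit cells can thus be
  charged to pairs in a common cell.\<close>

lemma card_pairs_shift_le:
  fixes k :: "'a \<Rightarrow> int"
  assumes "finite A"
  shows "card {(i, j). i \<in> A \<and> j \<in> A \<and> k i = k j + h} \<le> card {(i, j). i \<in> A \<and> j \<in> A \<and> k i = k j}"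
proof -
  define n where "n \<kappa> = real (card {i\<in>A. k i = \<kappa>})" for \<kappa>
  have fin: "finite (k ` A)" using assms by simp
  have eq: "real (card {(i, j). i \<in> A \<and> j \<in> A \<and> k i = k j}) = (\<Sum>\<kappa>\<in>k ` A. (n \<kappa>)\<^sup>2)"
    using card_pairs_eq_sum[OF assms, of k "\<lambda>x. x"] by (simp add: n_def power2_eq_square)
  have "real (card {(i, j). i \<in> A \<and> j \<in> A \<and> k i = k j + h}) = (\<Sum>\<kappa>\<in>k ` A. n (\<kappa> + h) * n \<kappa>)"
    using card_pairs_eq_sum[OF assms, of k "\<lambda>x. x + h"] by (simp add: n_def)
  also have "\<dots> \<le> (\<Sum>\<kappa>\<in>k ` A. (n (\<kappa> + h))\<^sup>2 / 2 + (n \<kappa>)\<^sup>2 / 2)"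
  proof (rule sum_mono)
    fix \<kappa>
    show "n (\<kappa> + h) * n \<kappa> \<le> (n (\<kappa> + h))\<^sup>2 / 2 + (n \<kappa>)\<^sup>2 / 2"
      using sum_squares_bound[of "n (\<kappa> + h)" "n \<kappa>"] by simp
  qed
  also have "\<dots> = (\<Sum>\<kappa>\<in>k ` A. (n (\<kappa> + h))\<^sup>2) / 2 + (\<Sum>\<kappa>\<in>k ` A. (n \<kappa>)\<^sup>2) / 2"
    by (simp add: sum.distrib sum_divide_distrib)
  also have "(\<Sum>\<kappa>\<in>k ` A. (n (\<kappa> + h))\<^sup>2) = (\<Sum>\<kappa>\<in>(\<lambda>\<kappa>. \<kappa> + h) ` k ` A. (n \<kappa>)\<^sup>2)"
    by (subst sum.reindex) (auto simp: inj_on_def)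
  also have "\<dots> \<le> (\<Sum>\<kappa>\<in>(\<lambda>\<kappa>. \<kappa> + h) ` k ` A \<union> k ` A. (n \<kappa>)\<^sup>2)"
    by (rule sum_mono2) (use fin in auto)
  also have "\<dots> = (\<Sum>\<kappa>\<in>k ` A. (n \<kappa>)\<^sup>2)"
  proof (rule sum.mono_neutral_right)
    show "\<forall>\<kappa>\<in>(\<lambda>\<kappa>. \<kappa> + h) ` k ` A \<union> k ` A - k ` A. (n \<kappa>)\<^sup>2 = 0"
    proof
      fix \<kappa> assume "\<kappa> \<in> (\<lambda>\<kappa>. \<kappa> + h) ` k ` A \<union> k ` A - k ` A"
      then have "{i\<in>A. k i = \<kappa>} = {}" by auto
      then show "(n \<kappa>)\<^sup>2 = 0"
        unfolding n_def by (simp only: card.empty of_nat_0 power2_eq_square mult_zero_left)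
    qed
  qed (use fin in auto)
  finally show ?thesis using eq by linarith
qed

lemma sum_half_power_abs_le:
  fixes H :: "int set"
  assumes "finite H"
  shows "(\<Sum>h\<in>H. (1/2::real) ^ nat \<bar>h\<bar>) \<le> 3"
proof -
  have *: "(\<Sum>h\<in>{- int n..int n}. (1/2::real) ^ nat \<bar>h\<bar>) \<le> 3 - 2 * (1/2) ^ n" for n
  proof (induction n)
    case (Suc n)
    have "{- int (Suc n)..int (Suc n)} = insert (- int (Suc n)) (insert (int (Suc n)) {- int n..int n})"
      by auto
    moreover have "nat \<bar>- int (Suc n)\<bar> = Suc n" "nat \<bar>int (Suc n)\<bar> = Suc n" by auto
    ultimately show ?case using Suc by (simp del: of_nat_Suc)
  qed simp
  define n where "n = nat (Max (insert 0 (abs ` H)))"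
  have "H \<subseteq> {- int n..int n}"
  proof
    fix h assume "h \<in> H"
    then have "\<bar>h\<bar> \<le> Max (insert 0 (abs ` H))" using assms by (intro Max_ge) auto
    then show "h \<in> {- int n..int n}" by (auto simp: n_def)
  qed
  then have "(\<Sum>h\<in>H. (1/2::real) ^ nat \<bar>h\<bar>) \<le> (\<Sum>h\<in>{- int n..int n}. (1/2::real) ^ nat \<bar>h\<bar>)"
    by (intro sum_mono2) auto
  also have "\<dots> \<le> 3 - 2 * (1/2) ^ n" by (rule *)
  also have "\<dots> \<le> 3" by simp
  finally show ?thesis .
qed

text \<open>From (|u| - 1)^2 >= 0 the Gaussian is at most e^(1/2 - |u|), and the floors differ by at
  most |u| + 1. This leaves e^(3/2) e^(-h), where e^(3/2) <= 6 and e^-1 <= 1/2.\<close>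

lemma gauss_diff_le: "gauss (x - y) \<le> 6 * (1/2) ^ nat \<bar>\<lfloor>x\<rfloor> - \<lfloor>y\<rfloor>\<bar>"
proof -
  define h where "h = nat \<bar>\<lfloor>x\<rfloor> - \<lfloor>y\<rfloor>\<bar>"
  have h: "real h \<le> \<bar>x - y\<bar> + 1" unfolding h_def by linarith
  have e3: "exp (3/2::real) \<le> 6"
  proof (rule power2_le_imp_le)
    have "exp (3/2::real) ^ 2 = exp 1 ^ 3" by (simp flip: exp_of_nat_mult)
    also have "\<dots> \<le> 3 ^ 3" by (intro power_mono exp_le) auto
    finally show "exp (3/2::real) ^ 2 \<le> 6 ^ 2" by simp
  qed simp
  have e2: "exp (- real h) \<le> (1/2) ^ h"
  proof -
    have "exp (- real h) = exp (- 1) ^ h" by (simp flip: exp_of_nat_mult)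
    also have "exp (- 1 :: real) \<le> 1/2"
      using exp_ge_add_one_self[of 1] by (simp add: exp_minus field_simps)
    then have "exp (- 1 :: real) ^ h \<le> (1/2) ^ h" by (intro power_mono) auto
    finally show ?thesis .
  qed
  have "0 \<le> (\<bar>x - y\<bar> - 1)\<^sup>2" by simp
  then have "- (x - y)\<^sup>2 / 2 \<le> 1/2 - \<bar>x - y\<bar>"
    unfolding power2_diff[of "\<bar>x - y\<bar>"] power2_abs by simp
  also have "\<dots> \<le> 3/2 + - real h" using h by simp
  finally have "gauss (x - y) \<le> exp (3/2 + - real h)" by simp
  also have "\<dots> = exp (3/2) * exp (- real h)" by (rule exp_add)
  also have "\<dots> \<le> 6 * (1/2) ^ h" using e3 e2 by (intro mult_mono) auto
  finally show ?thesis by (simp add: h_def)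
qed

text \<open>Ordered pairs with the diagonal included, as in the expansion of a mean square; the
  strict inequality is that of \<open>energy\<close>.\<close>

definition near :: "'a set \<Rightarrow> ('a \<Rightarrow> real) \<Rightarrow> real \<Rightarrow> nat" where
  "near A p r = card {(i, j). i \<in> A \<and> j \<in> A \<and> \<bar>p i - p j\<bar> < r}"

lemma finite_pairs: "finite A \<Longrightarrow> finite {(i, j). i \<in> A \<and> j \<in> A \<and> R i j}"
  by (rule finite_subset[OF _ finite_cartesian_product]) auto

lemma card_floor_pairs_le_near:
  assumes "finite A"
  shows "card {(i, j). i \<in> A \<and> j \<in> A \<and> \<lfloor>p i\<rfloor> = \<lfloor>p j\<rfloor>} \<le> near A p 1"
  unfolding near_def
proof (rule card_mono[OF finite_pairs[OF assms]], safe)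
  fix i j assume "\<lfloor>p i\<rfloor> = \<lfloor>p j\<rfloor>"
  then show "\<bar>p i - p j\<bar> < 1" by linarith
qed

text \<open>Sort the pairs by the difference h of the floors. Each class is no larger than the class
  h = 0, whose pairs are closer than 1; the factor 18 is 6 times the geometric sum 3.\<close>

lemma sum_gauss_le_near:
  assumes "finite A"
  shows "(\<Sum>i\<in>A. \<Sum>j\<in>A. gauss (p i - p j)) \<le> 18 * real (near A p 1)"
proof -
  define k where "k i = \<lfloor>p i\<rfloor>" for i
  define c where "c = real (card {(i, j). i \<in> A \<and> j \<in> A \<and> k i = k j})"
  define g where "g = (\<lambda>(i, j). k i - k j)"
  define H where "H = g ` (A \<times> A)"
  have finH: "finite H" using assms by (simp add: H_def)
  have "(\<Sum>i\<in>A. \<Sum>j\<in>A. gauss (p i - p j)) \<le> (\<Sum>i\<in>A. \<Sum>j\<in>A. 6 * (1/2) ^ nat \<bar>k i - k j\<bar>)"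
    unfolding k_def by (intro sum_mono gauss_diff_le)
  also have "\<dots> = (\<Sum>q\<in>A \<times> A. 6 * (1/2) ^ nat \<bar>g q\<bar>)"
    by (simp add: sum.cartesian_product g_def case_prod_unfold)
  also have "\<dots> = (\<Sum>h\<in>H. \<Sum>q\<in>{q \<in> A \<times> A. g q = h}. 6 * (1/2) ^ nat \<bar>g q\<bar>)"
    unfolding H_def using assms by (intro sum.group[symmetric]) auto
  also have "\<dots> = (\<Sum>h\<in>H. 6 * (1/2) ^ nat \<bar>h\<bar> * card {(i, j). i \<in> A \<and> j \<in> A \<and> k i = k j + h})"
  proof (rule sum.cong[OF refl])
    fix h
    have "(\<Sum>q\<in>{q \<in> A \<times> A. g q = h}. 6 * (1/2::real) ^ nat \<bar>g q\<bar>) =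
        (\<Sum>q\<in>{q \<in> A \<times> A. g q = h}. 6 * (1/2) ^ nat \<bar>h\<bar>)" by (intro sum.cong) auto
    moreover have "{q \<in> A \<times> A. g q = h} = {(i, j). i \<in> A \<and> j \<in> A \<and> k i = k j + h}"
      by (auto simp: g_def)
    ultimately show "(\<Sum>q\<in>{q \<in> A \<times> A. g q = h}. 6 * (1/2) ^ nat \<bar>g q\<bar>) = 
        6 * (1/2) ^ nat \<bar>h\<bar> * card {(i, j). i \<in> A \<and> j \<in> A \<and> k i = k j + h}"
      by (simp add: mult.commute)
  qed
  also have "\<dots> \<le> (\<Sum>h\<in>H. 6 * (1/2) ^ nat \<bar>h\<bar> * c)"
    unfolding c_def using card_pairs_shift_le[OF assms, of k]
    by (intro sum_mono mult_left_mono) auto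
  also have "\<dots> = 6 * c * (\<Sum>h\<in>H. (1/2) ^ nat \<bar>h\<bar>)"
    by (simp add: sum_distrib_left sum_distrib_right mult_ac)
  also have "\<dots> \<le> 6 * c * 3"
    by (intro mult_left_mono sum_half_power_abs_le finH) (simp add: c_def)
  also have "c \<le> near A p 1"
    unfolding c_def k_def of_nat_le_iff by (rule card_floor_pairs_le_near[OF assms])
  finally show ?thesis by simp
qed

subsection \<open>Near coincidences of products\<close>

text \<open>This and its converse \<open>abs_diff_le_ln\<close> pass between closeness of products
  and closeness of their logarithms, which is additive in the factors.\<close>

lemma abs_ln_diff_le:
  fixes u v m :: real
  assumes "m > 0" "u \<ge> m" "v \<ge> m"
  shows "\<bar>ln u - ln v\<bar> \<le> \<bar>u - v\<bar> / m"
proof -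
  have *: "ln a - ln b \<le> (a - b) / m" if "m \<le> b" "b \<le> a" for a b
  proof -
    have "ln a - ln b = ln (a / b)" using that assms by (simp add: ln_div)
    also have "\<dots> \<le> a / b - 1" using that assms by (intro ln_le_minus_one) auto
    also have "\<dots> = (a - b) / b" using that assms by (simp add: field_simps)
    also have "\<dots> \<le> (a - b) / m" using that assms by (intro divide_left_mono) auto
    finally show ?thesis .
  qed
  show ?thesis
  proof (cases "u \<le> v")
    case True
    then have "ln u \<le> ln v" using assms by simp
    then show ?thesis using *[of u v] assms True by simp
  next
    case False
    then have "ln v \<le> ln u" using assms by simp
    then show ?thesis using *[of v u] assms False by simp
  qed
qed

lemma abs_diff_le_ln:
  fixes u v M :: real
  assumes "0 < u" "0 < v" "u \<le> M" "v \<le> M"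
  shows "\<bar>u - v\<bar> \<le> M * \<bar>ln u - ln v\<bar>"
proof -
  have *: "a - b \<le> M * (ln a - ln b)" if "0 < b" "b \<le> a" "a \<le> M" for a b
  proof -
    have "1 - b / a \<le> ln a - ln b"
      using ln_le_minus_one[of "b / a"] that by (simp add: ln_div)
    then have "a * (1 - b / a) \<le> a * (ln a - ln b)" using that by (intro mult_left_mono) auto
    also have "\<dots> \<le> M * (ln a - ln b)" using that by (intro mult_right_mono) auto
    also have "a * (1 - b / a) = a - b" using that by (simp add: field_simps)
    finally show ?thesis .
  qed
  show ?thesis
  proof (cases "u \<le> v")
    case True
    then have "ln u \<le> ln v" using assms by simp
    then show ?thesis using *[of u v] assms True by simp
  next
    case False
    then have "ln v \<le> ln u" using assms by simp
    then show ?thesis using *[of v u] assms False by simp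
  qed
qed

lemma expsum_mult:
  "expsum A (\<lambda>_. 1) p t * expsum B (\<lambda>_. 1) q t = expsum (A \<times> B) (\<lambda>_. 1) (\<lambda>(a, b). p a + q b) t"
  by (simp add: expsum_def sum_product sum.cartesian_product cis_mult case_prod_unfold distrib_right)

lemma integral_norm_expsum_square_le:
  assumes "finite A"
  shows "(\<integral>t. (norm (expsum A (\<lambda>_. 1) p t))\<^sup>2 \<partial>std_normal_distribution) \<le> 18 * real (near A p 1)"
  using sum_gauss_le_near[OF assms, of p] by (simp add: integral_norm_expsum_square)

text \<open>Every term of the expanded mean square is positive, so the far pairs may be dropped; on
  the others the Gaussian is at least exp(-R^2/2).\<close>

lemma near_le_integral:
  assumes "finite A" "\<And>i j. i \<in> A \<Longrightarrow> j \<in> A \<Longrightarrow> \<bar>q i - q j\<bar> < 1 \<Longrightarrow> \<bar>p i - p j\<bar> \<le> R"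
  shows "real (near A q 1) \<le> 
    exp (R\<^sup>2 / 2) * (\<integral>t. (norm (expsum A (\<lambda>_. 1) p t))\<^sup>2 \<partial>std_normal_distribution)"
proof -
  let ?X = "{(i, j). i \<in> A \<and> j \<in> A \<and> \<bar>q i - q j\<bar> < 1}"
  have "real (near A q 1) = (\<Sum>(i, j)\<in>?X. 1)" by (simp add: near_def)
  also have "\<dots> \<le> (\<Sum>(i, j)\<in>?X. exp (R\<^sup>2 / 2) * gauss (p i - p j))"
  proof (intro sum_mono, clarify)
    fix i j assume "i \<in> A" "j \<in> A" "\<bar>q i - q j\<bar> < 1"
    then have "\<bar>p i - p j\<bar> \<le> R" by (rule assms(2))
    then have "(p i - p j)\<^sup>2 \<le> R\<^sup>2" by (rule abs_le_square_iff[THEN iffD1, OF order_trans]) simp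
    then show "1 \<le> exp (R\<^sup>2 / 2) * gauss (p i - p j)" by (simp flip: exp_add)
  qed
  also have "\<dots> \<le> (\<Sum>(i, j)\<in>A \<times> A. exp (R\<^sup>2 / 2) * gauss (p i - p j))"
    using assms(1) by (intro sum_mono2) auto
  also have "\<dots> = exp (R\<^sup>2 / 2) * (\<Sum>i\<in>A. \<Sum>j\<in>A. gauss (p i - p j))"
    by (simp add: sum.cartesian_product sum_distrib_left case_prod_unfold)
  finally show ?thesis by (simp add: integral_norm_expsum_square)
qed

lemma card_nat_interval_le:
  assumes "h \<ge> 0"
  shows "finite {v::nat. \<bar>x - real v\<bar> < h}" "real (card {v::nat. \<bar>x - real v\<bar> < h}) \<le> 2 * h + 1"
proof -
  let ?V = "{v::nat. \<bar>x - real v\<bar> < h}" and ?I = "{\<lfloor>x - h\<rfloor> + 1..\<lceil>x + h\<rceil> - 1}"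
  have sub: "int ` ?V \<subseteq> ?I"
  proof
    fix y assume "y \<in> int ` ?V"
    then obtain v where v: "y = int v" "\<bar>x - real v\<bar> < h" by auto
    then have "x - h < of_int y" "of_int y < x + h" by (auto simp: abs_less_iff)
    then show "y \<in> ?I" by (simp add: floor_less_iff less_ceiling_iff add1_zle_eq zle_diff1_eq)
  qed
  have "finite (int ` ?V)" by (rule finite_subset[OF sub]) simp
  then show "finite ?V" by (rule finite_imageD) (simp add: inj_on_def)
  have "card ?V = card (int ` ?V)" by (simp add: card_image inj_on_def)
  also have "\<dots> \<le> card ?I" by (rule card_mono[OF _ sub]) simp
  also have "\<dots> = nat (\<lceil>x + h\<rceil> - 1 - \<lfloor>x - h\<rfloor>)" by simp
  finally have "real (card ?V) \<le> real (nat (\<lceil>x + h\<rceil> - 1 - \<lfloor>x - h\<rfloor>))" by simp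
  also have "\<dots> \<le> 2 * h + 1"
    using assms by linarith
  finally show "real (card ?V) \<le> 2 * h + 1" .
qed

lemma card_triple_products_le:
  fixes v :: nat
  assumes "v > 0"
  shows "card {(a, b, c). a \<in> A \<and> b \<in> B \<and> c \<in> C \<and> a * b * c = v} \<le> (card {d. d dvd v})\<^sup>2"
proof -
  let ?X = "{(a, b, c). a \<in> A \<and> b \<in> B \<and> c \<in> C \<and> a * b * c = v}" and ?D = "{d. d dvd v}"
  have "inj_on (\<lambda>(a, b, c). (a, b)) ?X" using assms by (auto simp: inj_on_def)
  then have "card ?X = card ((\<lambda>(a, b, c). (a, b)) ` ?X)" by (simp add: card_image)
  also have "\<dots> \<le> card (?D \<times> ?D)"
    using assms by (intro card_mono) (auto intro: dvd_mult dvd_mult2)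
  finally show ?thesis by (simp add: card_cartesian_product power2_eq_square)
qed

text \<open>Fix one triple. The product of the other lies in an interval with at most 2 h + 1
  integers, and each of these splits into three factors in at most D^2 ways, two divisors
  determining the third.\<close>

lemma near_triple_products_le:
  fixes J :: nat and D h :: real
  assumes J: "J \<ge> 1" and h: "h \<ge> 0"
    and D: "\<And>v. 1 \<le> v \<Longrightarrow> v \<le> 8 * J ^ 3 \<Longrightarrow> real (card {d. d dvd v}) \<le> D"
  shows "real (near ({J..<2*J} \<times> {J..<2*J} \<times> {J..<2*J}) (\<lambda>(a, b, c). real (a * b * c)) h)
           \<le> real J ^ 3 * ((2 * h + 1) * D\<^sup>2)"
proof -
  define I where "I = {J..<2*J}"
  define S where "S = I \<times> I \<times> I"
  define \<pi> where "\<pi> = (\<lambda>(a, b, c). a * b * c :: nat)"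
  have finS: "finite S" by (simp add: S_def I_def)
  have \<pi>: "1 \<le> \<pi> s" "\<pi> s \<le> 8 * J ^ 3" if "s \<in> S" for s
  proof -
    obtain a b c where s: "s = (a, b, c)" by (cases s)
    have "a * b * c \<le> (2 * J) * (2 * J) * (2 * J)"
      using that by (intro mult_mono) (auto simp: s S_def I_def)
    then show "\<pi> s \<le> 8 * J ^ 3" by (simp add: \<pi>_def s power3_eq_cube)
    have "a * b * c > 0" using that J by (auto simp: s S_def I_def)
    then show "1 \<le> \<pi> s" by (simp add: \<pi>_def s)
  qed
  have fibre: "real (card {s'\<in>S. \<pi> s' = v}) \<le> D\<^sup>2" for v
  proof (cases "{s'\<in>S. \<pi> s' = v} = {}")
    case False
    then have v: "1 \<le> v" "v \<le> 8 * J ^ 3" using \<pi> by auto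
    have "{s'\<in>S. \<pi> s' = v} = {(a, b, c). a \<in> I \<and> b \<in> I \<and> c \<in> I \<and> a * b * c = v}"
      by (auto simp: S_def \<pi>_def)
    then have "real (card {s'\<in>S. \<pi> s' = v}) \<le> (real (card {d. d dvd v}))\<^sup>2"
      using card_triple_products_le[of v I I I] v by (simp flip: of_nat_power)
    also have "\<dots> \<le> D\<^sup>2" using D[OF v] by (intro power_mono) auto
    finally show ?thesis .
  next
    case True
    then show ?thesis by (simp only: card.empty of_nat_0 zero_le_power2)
  qed
  have each: "real (card {s'\<in>S. \<bar>real (\<pi> s) - real (\<pi> s')\<bar> < h}) \<le> (2 * h + 1) * D\<^sup>2" for s
  proof -
    let ?V = "{v::nat. \<bar>real (\<pi> s) - real v\<bar> < h}"
    have "{s'\<in>S. \<bar>real (\<pi> s) - real (\<pi> s')\<bar> < h} = (\<Union>v\<in>?V. {s'\<in>S. \<pi> s' = v})" by auto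
    then have "real (card {s'\<in>S. \<bar>real (\<pi> s) - real (\<pi> s')\<bar> < h}) \<le> (\<Sum>v\<in>?V. real (card {s'\<in>S. \<pi> s' = v}))"
      using card_UN_le[OF card_nat_interval_le(1)[OF h, of "real (\<pi> s)"], of "\<lambda>v. {s'\<in>S. \<pi> s' = v}"]
      by (simp flip: of_nat_sum)
    also have "\<dots> \<le> (\<Sum>v\<in>?V. D\<^sup>2)" by (intro sum_mono fibre)
    also have "\<dots> = real (card ?V) * D\<^sup>2" by simp
    also have "\<dots> \<le> (2 * h + 1) * D\<^sup>2"
      by (intro mult_right_mono card_nat_interval_le h) auto
    finally show ?thesis .
  qed
  have "{(s, s'). s \<in> S \<and> s' \<in> S \<and> \<bar>real (\<pi> s) - real (\<pi> s')\<bar> < h} =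
      Sigma S (\<lambda>s. {s'\<in>S. \<bar>real (\<pi> s) - real (\<pi> s')\<bar> < h})" by auto
  then have "real (near S (\<lambda>s. real (\<pi> s)) h) = (\<Sum>s\<in>S. real (card {s'\<in>S. \<bar>real (\<pi> s) - real (\<pi> s')\<bar> < h}))"
    using finS by (simp add: near_def)
  also have "\<dots> \<le> (\<Sum>s\<in>S. (2 * h + 1) * D\<^sup>2)" by (intro sum_mono each)
  also have "\<dots> = real J ^ 3 * ((2 * h + 1) * D\<^sup>2)"
    by (simp add: S_def I_def card_cartesian_product power3_eq_cube)
  finally show ?thesis by (simp add: S_def I_def \<pi>_def case_prod_unfold)
qed

lemma square_mult_le_threshold:
  fixes Z P K M :: real
  assumes "K > 0" "0 \<le> Z" "0 \<le> P" "P \<le> M"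
  shows "(Z * P)\<^sup>2 \<le> K\<^sup>2 * P\<^sup>2 + M\<^sup>2 / K ^ 4 * Z ^ 6"
proof (cases "Z \<le> K")
  case True
  then have "(Z * P)\<^sup>2 \<le> K\<^sup>2 * P\<^sup>2"
    unfolding power_mult_distrib using assms by (intro mult_right_mono power_mono) auto
  moreover have "0 \<le> M\<^sup>2 / K ^ 4 * Z ^ 6" by simp
  ultimately show ?thesis by linarith
next
  case False
  have "K ^ 4 * (Z * P)\<^sup>2 \<le> Z ^ 4 * (Z * M)\<^sup>2"
    using assms False by (intro mult_mono power_mono) auto
  also have "\<dots> = M\<^sup>2 * Z ^ 6" by (simp add: power_mult_distrib flip: power_add)
  finally have "(Z * P)\<^sup>2 \<le> M\<^sup>2 / K ^ 4 * Z ^ 6" using assms by (simp add: field_simps)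
  moreover have "0 \<le> K\<^sup>2 * P\<^sup>2" by simp
  ultimately show ?thesis by linarith
qed

text \<open>The coincidences are bounded by the mean of |Z P|^2, which is split at |Z| =
  \<open>K\<close>. The first term comes from small Z. The others come from large Z, with |P| <=
  card W and the sixth moment: J^3 accounts for equal products, and J^5/(G L) for products that the
  time scale \<open>T\<close> cannot separate.\<close>

lemma near_window_le:
  fixes W :: "'a set" and z :: "'a \<Rightarrow> real" and J :: nat and K G L D :: real
  assumes fin: "finite W" and J: "J \<ge> 1" and K: "K > 0" and G: "G \<ge> 1" and L: "L > 0"
    and W: "\<And>a. a \<in> W \<Longrightarrow> L \<le> z a" "\<And>a. a \<in> W \<Longrightarrow> z a < G * L"
    and D: "\<And>v. 1 \<le> v \<Longrightarrow> v \<le> 8 * J ^ 3 \<Longrightarrow> real (card {d. d dvd v}) \<le> D"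
  shows "real (near ({J..<2*J} \<times> W) (\<lambda>(j, a). real j * z a) 1) \<le>
    18 * exp (G\<^sup>2 / 2) * (K\<^sup>2 * real (near W z (1 / real J)) +
      D\<^sup>2 / K ^ 4 * (real J ^ 3 * (real (card W))\<^sup>2
        + 16 * real J ^ 5 * (real (card W))\<^sup>2 / (G * L)))"
proof -
  define I where "I = {J..<2*J}"
  \<comment> \<open>On a window [L, G L) this scale fits in both directions: |j z - l z'| < 1 forces
    phases within T/(J L) = G, and phases of P within 1 force |z - z'| < G L/T = 1/J, the energy
    parameter.\<close>
  define T where "T = G * real J * L"
  have T: "T > 0" using assms by (simp add: T_def)
  define Z where "Z = expsum I (\<lambda>_. 1) (\<lambda>j. T * ln (real j))"
  define P where "P = expsum W (\<lambda>_. 1) (\<lambda>a. T * ln (z a))"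
  have finI: "finite I" by (simp add: I_def)
  have Ipos: "real j > 0" "real j \<ge> real J" "real j \<le> 2 * real J" if "j \<in> I" for j
    using that J by (auto simp: I_def)
  have zpos: "z a > 0" if "a \<in> W" for a using W(1)[OF that] L by linarith
  have int2: "integrable std_normal_distribution (\<lambda>t. (norm (P t))\<^sup>2)"
    and int6: "integrable std_normal_distribution (\<lambda>t. norm (Z t) ^ 6)"
    unfolding P_def Z_def by (rule integrable_norm_expsum_power, simp)+

  have 1: "real (near (I \<times> W) (\<lambda>(j, a). real j * z a) 1) \<le> 
      exp (G\<^sup>2 / 2) * (\<integral>t. (norm (expsum (I \<times> W) (\<lambda>_. 1) (\<lambda>(j, a). T * ln (real j) + T * ln (z a)) t))\<^sup>2
        \<partial>std_normal_distribution)"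
  proof (rule near_le_integral)
    fix r s assume rs: "r \<in> I \<times> W" "s \<in> I \<times> W"
      and close: "\<bar>(case r of (j, a) \<Rightarrow> real j * z a) - (case s of (j, a) \<Rightarrow> real j * z a)\<bar> < 1"
    obtain j a l b where [simp]: "r = (j, a)" "s = (l, b)" by (cases r, cases s) auto
    have mem: "j \<in> I" "l \<in> I" "a \<in> W" "b \<in> W" using rs by auto
    have JL: "0 < real J * L" using J L by simp
    have "real J * L \<le> real j * z a" "real J * L \<le> real l * z b"
      using mem Ipos W L J by (auto intro!: mult_mono)
    then have "\<bar>ln (real j * z a) - ln (real l * z b)\<bar> \<le> \<bar>real j * z a - real l * z b\<bar> / (real J * L)"
      by (rule abs_ln_diff_le[OF JL])
    also have "\<dots> \<le> 1 / (real J * L)" using close JL by (intro divide_right_mono) auto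
    finally have "T * \<bar>ln (real j * z a) - ln (real l * z b)\<bar> \<le> T * (1 / (real J * L))"
      using T by (intro mult_left_mono) auto
    also have "T * (1 / (real J * L)) = G" using JL J L by (simp add: T_def)
    finally have "\<bar>T * ln (real j * z a) - T * ln (real l * z b)\<bar> \<le> G"
      using T by (simp add: abs_mult right_diff_distrib[symmetric])
    then show "\<bar>(case r of (j, a) \<Rightarrow> T * ln (real j) + T * ln (z a)) - 
        (case s of (j, a) \<Rightarrow> T * ln (real j) + T * ln (z a))\<bar> \<le> G"
      using mem Ipos zpos by (simp add: ln_mult_pos distrib_left)
  qed (use fin finI in auto)
  have "(\<integral>t. (norm (expsum (I \<times> W) (\<lambda>_. 1) (\<lambda>(j, a). T * ln (real j) + T * ln (z a)) t))\<^sup>2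
        \<partial>std_normal_distribution) = (\<integral>t. (norm (Z t) * norm (P t))\<^sup>2 \<partial>std_normal_distribution)"
    unfolding Z_def P_def norm_mult[symmetric] expsum_mult ..
  also have "\<dots> \<le> (\<integral>t. K\<^sup>2 * (norm (P t))\<^sup>2 + (real (card W))\<^sup>2 / K ^ 4 * norm (Z t) ^ 6 \<partial>std_normal_distribution)"
  proof (rule integral_mono)
    show "integrable std_normal_distribution (\<lambda>t. (norm (Z t) * norm (P t))\<^sup>2)"
      unfolding Z_def P_def norm_mult[symmetric] expsum_mult
      by (rule integrable_norm_expsum_power) simp
    have "norm (P t) \<le> real (card W)" for t
      unfolding P_def using norm_expsum_le[of W "\<lambda>_. 1"] by simp
    then show "(norm (Z t) * norm (P t))\<^sup>2 \<le> 
        K\<^sup>2 * (norm (P t))\<^sup>2 + (real (card W))\<^sup>2 / K ^ 4 * norm (Z t) ^ 6" for t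
      by (intro square_mult_le_threshold K) auto
  qed (use int2 int6 in simp)
  also have "\<dots> = K\<^sup>2 * (\<integral>t. (norm (P t))\<^sup>2 \<partial>std_normal_distribution) + 
      (real (card W))\<^sup>2 / K ^ 4 * (\<integral>t. norm (Z t) ^ 6 \<partial>std_normal_distribution)"
    using int2 int6 by simp
  also have "\<dots> \<le> K\<^sup>2 * (18 * real (near W z (1 / real J))) + 
      (real (card W))\<^sup>2 / K ^ 4 * (18 * (real J ^ 3 * ((2 * (8 * real J ^ 3 / T) + 1) * D\<^sup>2)))"
  proof (intro add_mono mult_left_mono)
    have "near W (\<lambda>a. T * ln (z a)) 1 \<le> near W z (1 / real J)"
      unfolding near_def
    proof (rule card_mono[OF finite_pairs[OF fin]], safe)
      fix a b assume ab: "a \<in> W" "b \<in> W" and close: "\<bar>T * ln (z a) - T * ln (z b)\<bar> < 1"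
      have "T * \<bar>ln (z a) - ln (z b)\<bar> < 1"
        using close T by (simp add: abs_mult right_diff_distrib[symmetric])
      then have "\<bar>ln (z a) - ln (z b)\<bar> < 1 / T" using T by (simp add: field_simps)
      then have "G * L * \<bar>ln (z a) - ln (z b)\<bar> < G * L * (1 / T)"
        using G L by (intro mult_strict_left_mono) auto
      moreover have "\<bar>z a - z b\<bar> \<le> G * L * \<bar>ln (z a) - ln (z b)\<bar>"
        using ab zpos W(2) by (intro abs_diff_le_ln) (auto intro: less_imp_le)
      moreover have "G * L * (1 / T) = 1 / real J" using G L by (simp add: T_def)
      ultimately show "\<bar>z a - z b\<bar> < 1 / real J" by linarith
    qed
    then show "(\<integral>t. (norm (P t))\<^sup>2 \<partial>std_normal_distribution) \<le> 18 * real (near W z (1 / real J))"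
      unfolding P_def by (intro order_trans[OF integral_norm_expsum_square_le[OF fin]]) simp
  next
    let ?S = "I \<times> I \<times> I"
    let ?p = "\<lambda>(a, b, c). T * ln (real a) + (T * ln (real b) + T * ln (real c))"
    \<comment> \<open>The cube of Z is an exponential sum over triples, so its sixth moment is a
      mean square.\<close>
    have "norm (Z t) ^ 6 = (norm (expsum ?S (\<lambda>_. 1) ?p t))\<^sup>2" for t
    proof -
      have Z3: "Z t * (Z t * Z t) = expsum ?S (\<lambda>_. 1) ?p t"
        unfolding Z_def expsum_mult by (simp add: case_prod_unfold)
      then have "norm (expsum ?S (\<lambda>_. 1) ?p t) = norm (Z t) ^ 3"
        unfolding Z3[symmetric] by (simp only: norm_mult power3_eq_cube mult.assoc)
      then show ?thesis by (simp flip: power_mult)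
    qed
    then have "(\<integral>t. norm (Z t) ^ 6 \<partial>std_normal_distribution) = 
        (\<integral>t. (norm (expsum ?S (\<lambda>_. 1) ?p t))\<^sup>2 \<partial>std_normal_distribution)" by simp
    then have "(\<integral>t. norm (Z t) ^ 6 \<partial>std_normal_distribution) \<le> 18 * real (near ?S ?p 1)"
      by (simp only:) (rule integral_norm_expsum_square_le, simp add: finI)
    moreover have "near ?S ?p 1 \<le> near ?S (\<lambda>(a, b, c). real (a * b * c)) (8 * real J ^ 3 / T)"
      unfolding near_def
    proof (rule card_mono[OF finite_pairs], simp add: finI, safe)
      fix a b c a' b' c' assume mem: "a \<in> I" "b \<in> I" "c \<in> I" "a' \<in> I" "b' \<in> I" "c' \<in> I"
        and close: "\<bar>T * ln (real a) + (T * ln (real b) + T * ln (real c)) -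
             (T * ln (real a') + (T * ln (real b') + T * ln (real c')))\<bar> < 1"
      define u v where "u = real (a * b * c)" and "v = real (a' * b' * c')"
      have uv: "0 < u" "0 < v" using mem Ipos(1) by (auto simp: u_def v_def)
      have b3: "x * y * w \<le> 8 * real J ^ 3" 
        if "0 \<le> x" "0 \<le> y" "0 \<le> w" "x \<le> 2 * real J" "y \<le> 2 * real J" "w \<le> 2 * real J" for x y w
      proof -
        have "x * y * w \<le> (2 * real J) * (2 * real J) * (2 * real J)"
          using that by (intro mult_mono) auto
        then show ?thesis by (simp add: power3_eq_cube)
      qed
      have uv8: "u \<le> 8 * real J ^ 3" "v \<le> 8 * real J ^ 3"
        unfolding u_def v_def of_nat_mult using mem Ipos(3) by (auto intro!: b3)
      have "ln u = ln (real a) + (ln (real b) + ln (real c))" "ln v = ln (real a') + (ln (real b') + ln (real c'))"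
        using mem Ipos(1) by (auto simp: u_def v_def ln_mult_pos)
      then have "\<bar>T * (ln u - ln v)\<bar> < 1" using close by (simp add: algebra_simps)
      then have "T * \<bar>ln u - ln v\<bar> < 1" using T by (simp add: abs_mult)
      then have "\<bar>ln u - ln v\<bar> < 1 / T" using T by (simp add: field_simps)
      then have "8 * real J ^ 3 * \<bar>ln u - ln v\<bar> < 8 * real J ^ 3 * (1 / T)"
        using J by (intro mult_strict_left_mono) auto
      moreover have "\<bar>u - v\<bar> \<le> 8 * real J ^ 3 * \<bar>ln u - ln v\<bar>" by (rule abs_diff_le_ln[OF uv uv8])
      ultimately show "\<bar>real (a * b * c) - real (a' * b' * c')\<bar> < 8 * real J ^ 3 / T"
        by (simp add: u_def v_def)
    qed
    moreover have "real (near ?S (\<lambda>(a, b, c). real (a * b * c)) (8 * real J ^ 3 / T)) \<le> 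
        real J ^ 3 * ((2 * (8 * real J ^ 3 / T) + 1) * D\<^sup>2)"
      unfolding I_def by (rule near_triple_products_le[OF J _ D]) (use T in simp_all)
    ultimately show "(\<integral>t. norm (Z t) ^ 6 \<partial>std_normal_distribution) \<le> 
        18 * (real J ^ 3 * ((2 * (8 * real J ^ 3 / T) + 1) * D\<^sup>2))"
      by (meson mult_left_mono of_nat_le_iff order_trans zero_le_numeral)
  next
    show "0 \<le> K\<^sup>2" by simp
    show "0 \<le> (real (card W))\<^sup>2 / K ^ 4" by simp
  qed
  also have "\<dots> = 18 * (K\<^sup>2 * real (near W z (1 / real J)) +
      D\<^sup>2 / K ^ 4 * (real J ^ 3 * (real (card W))\<^sup>2
        + 16 * real J ^ 5 * (real (card W))\<^sup>2 / (G * L)))"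
  proof -
    have "real J ^ 3 * (2 * (8 * real J ^ 3 / T)) = 16 * real J ^ 5 / (G * L)"
      using J G L by (simp add: T_def field_simps power_numeral_reduce)
    then have "real J ^ 3 * ((2 * (8 * real J ^ 3 / T) + 1) * D\<^sup>2) = 
        (real J ^ 3 + 16 * real J ^ 5 / (G * L)) * D\<^sup>2"
      unfolding mult.assoc[symmetric] distrib_left by simp
    then show ?thesis by (simp only:) (simp add: algebra_simps)
  qed
  finally have "exp (G\<^sup>2 / 2) * (\<integral>t. (norm (expsum (I \<times> W) (\<lambda>_. 1) (\<lambda>(j, a). T * ln (real j) + T * ln (z a)) t))\<^sup>2
        \<partial>std_normal_distribution) \<le> exp (G\<^sup>2 / 2) * (18 * (K\<^sup>2 * real (near W z (1 / real J)) +
      D\<^sup>2 / K ^ 4 * (real J ^ 3 * (real (card W))\<^sup>2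
        + 16 * real J ^ 5 * (real (card W))\<^sup>2 / (G * L))))"
    by (rule mult_left_mono) simp
  from order_trans[OF 1 this] show ?thesis unfolding I_def by (simp only: mult.assoc mult.left_commute)
qed

text \<open>The window meets at most M + 2 unit cells, so many points in it must share cells. This
  converts the squared cardinality divided by the window length, left over from the sixth moment,
  into an energy with \<gamma> = 1.\<close>

lemma card_square_le_near:
  assumes fin: "finite W" and L: "L > 0" and W: "\<And>a. a \<in> W \<Longrightarrow> L \<le> z a" "\<And>a. a \<in> W \<Longrightarrow> z a < M"
    and LM: "L \<le> M"
  shows "(real (card W))\<^sup>2 \<le> (M + 2) * real (near W z 1)"
proof -
  have "(\<lambda>a. \<lfloor>z a\<rfloor>) ` W \<subseteq> {\<lfloor>L\<rfloor>..\<lfloor>M\<rfloor>}"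
    using W(1) less_imp_le[OF W(2)] by (auto intro!: floor_mono)
  then have "card ((\<lambda>a. \<lfloor>z a\<rfloor>) ` W) \<le> card {\<lfloor>L\<rfloor>..\<lfloor>M\<rfloor>}" by (intro card_mono) auto
  also have "\<dots> = nat (\<lfloor>M\<rfloor> + 1 - \<lfloor>L\<rfloor>)" by simp
  finally have "real (card ((\<lambda>a. \<lfloor>z a\<rfloor>) ` W)) \<le> real (nat (\<lfloor>M\<rfloor> + 1 - \<lfloor>L\<rfloor>))"
    by (simp only: of_nat_le_iff)
  also have "\<dots> \<le> M + 2" using LM L by linarith
  finally have *: "real (card ((\<lambda>a. \<lfloor>z a\<rfloor>) ` W)) \<le> M + 2" .
  have "(real (card W))\<^sup>2 \<le> real (card ((\<lambda>a. \<lfloor>z a\<rfloor>) ` W)) *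
      real (card {(i, j). i \<in> W \<and> j \<in> W \<and> \<lfloor>z i\<rfloor> = \<lfloor>z j\<rfloor>})"
    by (rule card_square_le_card_pairs[OF fin])
  also have "\<dots> \<le> (M + 2) * real (near W z 1)"
    using * card_floor_pairs_le_near[OF fin, of z] L LM by (intro mult_mono) auto
  finally show ?thesis .
qed

text \<open>The first member of a pair in W i determines i up to two choices. The relation is
  arbitrary so that the lemma covers \<open>near\<close> at every radius and, with the true
  relation, squared cardinalities.\<close>

lemma sum_windows_le:
  fixes \<kappa> :: "'a \<Rightarrow> int"
  assumes fin: "finite A"
  defines "W \<equiv> \<lambda>i. {a\<in>A. \<kappa> a = i \<or> \<kappa> a = i + 1}"
  shows "(\<Sum>i\<in>\<kappa> ` A. card {(a, b). a \<in> W i \<and> b \<in> W i \<and> R a b}) \<le>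
    2 * card {(a, b). a \<in> A \<and> b \<in> A \<and> R a b}"
proof -
  let ?X = "{(a, b). a \<in> A \<and> b \<in> A \<and> R a b}"
  have finX: "finite ?X" by (rule finite_pairs[OF fin])
  have fib: "(\<Sum>i\<in>\<kappa> ` A. card {q\<in>?X. f q = i}) \<le> card ?X" for f :: "'a \<times> 'a \<Rightarrow> int"
  proof -
    have "(\<Sum>i\<in>\<kappa> ` A. card {q\<in>?X. f q = i}) = card (\<Union>i\<in>\<kappa> ` A. {q\<in>?X. f q = i})"
      using fin finX by (intro card_UN_disjoint[symmetric]) auto
    also have "\<dots> \<le> card ?X" using finX by (intro card_mono) auto
    finally show ?thesis .
  qed
  have "(\<Sum>i\<in>\<kappa> ` A. card {(a, b). a \<in> W i \<and> b \<in> W i \<and> R a b}) \<le>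
    (\<Sum>i\<in>\<kappa> ` A. card {q\<in>?X. \<kappa> (fst q) = i} + card {q\<in>?X. \<kappa> (fst q) - 1 = i})"
  proof (rule sum_mono)
    fix i
    have "{(a, b). a \<in> W i \<and> b \<in> W i \<and> R a b} \<subseteq> {q\<in>?X. \<kappa> (fst q) = i} \<union> {q\<in>?X. \<kappa> (fst q) - 1 = i}"
      by (auto simp: W_def)
    then have "card {(a, b). a \<in> W i \<and> b \<in> W i \<and> R a b} \<le> card ({q\<in>?X. \<kappa> (fst q) = i} \<union> {q\<in>?X. \<kappa> (fst q) - 1 = i})"
      using finX by (intro card_mono) auto
    then show "card {(a, b). a \<in> W i \<and> b \<in> W i \<and> R a b} \<le> card {q\<in>?X. \<kappa> (fst q) = i} + card {q\<in>?X. \<kappa> (fst q) - 1 = i}"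
      using card_Un_le order_trans by blast
  qed
  also have "\<dots> = (\<Sum>i\<in>\<kappa> ` A. card {q\<in>?X. \<kappa> (fst q) = i}) + (\<Sum>i\<in>\<kappa> ` A. card {q\<in>?X. \<kappa> (fst q) - 1 = i})"
    by (rule sum.distrib)
  also have "\<dots> \<le> card ?X + card ?X" by (intro add_mono fib)
  finally show ?thesis by simp
qed

text \<open>
  If \<open>\<bar>j z - l z'\<bar> < 1\<close> with \<open>J \<le> j, l < 2J\<close> and \<open>z, z' \<ge> c\<close>, then \<open>z' < H z\<close> for \<open>H = 2 + 1/c\<close>, so \<open>z, z'\<close>
  lie in a common window \<open>[H\<^sup>i, H\<^sup>i\<^sup>+\<^sup>2)\<close>; each \<open>z\<close> lies in only two windows, whence no logarithmic
  factor is lost although the differences may be arbitrarily large.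
\<close>

definition window_const :: "real \<Rightarrow> real" where
  "window_const c = 36 * exp (((2 + 1 / c)\<^sup>2)\<^sup>2 / 2) * (16 * (1 + 2 * (2 + 1 / c)\<^sup>2 / c))"

lemma near_dyadic_le:
  fixes A :: "'a set" and z :: "'a \<Rightarrow> real" and J :: nat and K D :: real
  assumes fin: "finite A" and c: "c > 0" and z: "\<And>a. a \<in> A \<Longrightarrow> c \<le> z a"
    and J: "J \<ge> 1" and K: "K > 0"
    and D: "\<And>v. 1 \<le> v \<Longrightarrow> v \<le> 8 * J ^ 3 \<Longrightarrow> real (card {d. d dvd v}) \<le> D"
  shows "real (near ({J..<2*J} \<times> A) (\<lambda>(j, a). real j * z a) 1) \<le>
    window_const c * (K\<^sup>2 * real (near A z (1 / real J)) +
      D\<^sup>2 / K ^ 4 * (real J ^ 3 * (real (card A))\<^sup>2 + real J ^ 5 * real (near A z 1)))"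
proof -
  define H where "H = 2 + 1 / c"
  have H: "H > 2" using c by (simp add: H_def)
  \<comment> \<open>A window joins two consecutive powers of \<open>H\<close>.\<close>
  define G where "G = H\<^sup>2"
  have G: "G \<ge> 1" using H by (simp add: G_def)
  \<comment> \<open>Absorbs the factor 16 of the J^5 term and the inequality G L + 2 <= (1 + 2 G/c)
    G L, which holds as soon as c <= G L.\<close>
  define B where "B = 16 * (1 + 2 * G / c)"
  have B: "B \<ge> 1" using G c by (simp add: B_def)
  define E where "E = 18 * exp (G\<^sup>2 / 2) * B"
  have E: "E \<ge> 0" using B by (simp add: E_def)
  have wc: "window_const c = 2 * E" by (simp add: window_const_def E_def B_def G_def H_def)
  define \<kappa> where "\<kappa> a = \<lfloor>log H (z a)\<rfloor>" for a
  define W where "W = (\<lambda>i. {a\<in>A. \<kappa> a = i \<or> \<kappa> a = i + 1})"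
  define q where "q = (\<lambda>(j, a). real j * z a)"
  define I where "I = {J..<2*J}"
  have zpos: "z a > 0" if "a \<in> A" for a using z[OF that] c by linarith
  have finW: "finite (W i)" for i using fin by (simp add: W_def)
  define Y where "Y i = K\<^sup>2 * real (near (W i) z (1 / real J)) +
      D\<^sup>2 / K ^ 4 * (real J ^ 3 * (real (card (W i)))\<^sup>2 + real J ^ 5 * real (near (W i) z 1))" for i
  have window: "real (near (I \<times> W i) q 1) \<le> E * Y i" if i: "i \<in> \<kappa> ` A" for i
  proof -
    define L where "L = H powr of_int i"
    have L: "L > 0" using H by (simp add: L_def)
    have WL: "L \<le> z a" "z a < G * L" if "a \<in> W i" for a
    proof -
      have "of_int i \<le> log H (z a)" "log H (z a) < of_int i + 2"
        using that by (auto simp: W_def \<kappa>_def floor_eq_iff)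
      then have "H powr of_int i \<le> z a" "z a < H powr (of_int i + 2)"
        using H zpos that by (auto simp: W_def le_log_iff log_less_iff)
      then show "L \<le> z a" "z a < G * L"
        using H by (auto simp: L_def G_def powr_add mult.commute)
    qed
    \<comment> \<open>The lower end \<open>L\<close> may fall below \<open>c\<close>, but the window
      contains a point, so its upper end does not.\<close>
    have cL: "c \<le> G * L"
    proof -
      obtain a where "a \<in> A" "\<kappa> a = i" using i by auto
      then show ?thesis using z[of a] WL(2)[of a] by (auto simp: W_def)
    qed
    have LGL: "L \<le> G * L" using G L by simp
    have "(real (card (W i)))\<^sup>2 / (G * L) \<le> (1 + 2 * G / c) * real (near (W i) z 1)"
    proof -
      have "(real (card (W i)))\<^sup>2 \<le> (G * L + 2) * real (near (W i) z 1)"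
        by (rule card_square_le_near[OF finW L WL LGL])
      also have "\<dots> \<le> ((1 + 2 * G / c) * (G * L)) * real (near (W i) z 1)"
      proof (rule mult_right_mono)
        have "2 * 1 \<le> 2 * G * (G * L / c)" using cL c G by (intro mult_mono) auto
        then show "G * L + 2 \<le> (1 + 2 * G / c) * (G * L)" by (simp add: algebra_simps)
      qed simp
      finally show ?thesis using G L by (simp add: field_simps)
    qed
    then have "16 * real J ^ 5 * ((real (card (W i)))\<^sup>2 / (G * L)) \<le>
        16 * real J ^ 5 * ((1 + 2 * G / c) * real (near (W i) z 1))"
      by (intro mult_left_mono) auto
    then have l5: "16 * real J ^ 5 * (real (card (W i)))\<^sup>2 / (G * L) \<le> B * (real J ^ 5 * real (near (W i) z 1))"
      unfolding B_def by (simp only: mult_ac times_divide_eq_right)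
    have l3: "real J ^ 3 * (real (card (W i)))\<^sup>2 \<le> B * (real J ^ 3 * (real (card (W i)))\<^sup>2)"
      using mult_right_mono[OF B, of "real J ^ 3 * (real (card (W i)))\<^sup>2"] by simp
    have l1: "K\<^sup>2 * real (near (W i) z (1 / real J)) \<le> B * (K\<^sup>2 * real (near (W i) z (1 / real J)))"
      using mult_right_mono[OF B, of "K\<^sup>2 * real (near (W i) z (1 / real J))"] by simp
    have l2: "D\<^sup>2 / K ^ 4 * (real J ^ 3 * (real (card (W i)))\<^sup>2 + 16 * real J ^ 5 * (real (card (W i)))\<^sup>2 / (G * L)) \<le>
        D\<^sup>2 / K ^ 4 * (B * (real J ^ 3 * (real (card (W i)))\<^sup>2) + B * (real J ^ 5 * real (near (W i) z 1)))"
      by (intro mult_left_mono add_mono l3 l5) simp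
    have "real (near (I \<times> W i) q 1) \<le> 18 * exp (G\<^sup>2 / 2) * (K\<^sup>2 * real (near (W i) z (1 / real J)) +
      D\<^sup>2 / K ^ 4 * (real J ^ 3 * (real (card (W i)))\<^sup>2
        + 16 * real J ^ 5 * (real (card (W i)))\<^sup>2 / (G * L)))"
      unfolding I_def q_def by (rule near_window_le[OF finW J K G L WL D])
    also have "\<dots> \<le> 18 * exp (G\<^sup>2 / 2) * (B * (K\<^sup>2 * real (near (W i) z (1 / real J))) +
       D\<^sup>2 / K ^ 4 * (B * (real J ^ 3 * (real (card (W i)))\<^sup>2) + B * (real J ^ 5 * real (near (W i) z 1))))"
      by (intro mult_left_mono add_mono[OF l1 l2]) simp
    also have "\<dots> = E * Y i" by (simp add: E_def Y_def algebra_simps)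
    finally show ?thesis .
  qed
  have cover: "near (I \<times> A) q 1 \<le> (\<Sum>i\<in>\<kappa> ` A. near (I \<times> W i) q 1)"
  proof -
    let ?X = "\<lambda>A. {(r, s). r \<in> I \<times> A \<and> s \<in> I \<times> A \<and> \<bar>q r - q s\<bar> < 1}"
    have step: "\<kappa> b \<le> \<kappa> a + 1" if "j \<in> I" "l \<in> I" "a \<in> A" "b \<in> A" "\<bar>real j * z a - real l * z b\<bar> < 1" for j l a b
    proof -
      have "real J * z b \<le> real l * z b" "real j * z a \<le> real (2 * J) * z a"
        using that zpos[of a] zpos[of b] by (auto simp: I_def intro!: mult_right_mono)
      then have "real J * z b < 2 * real J * z a + 1" using that(5) by (simp add: abs_less_iff)
      also have "\<dots> \<le> 2 * real J * z a + real J * (z a / c)"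
      proof -
        have "1 * 1 \<le> real J * (z a / c)" using J z[OF that(3)] c by (intro mult_mono) auto
        then show ?thesis by simp
      qed
      also have "\<dots> = real J * (H * z a)" by (simp add: H_def algebra_simps)
      finally have "z b < H * z a" using J by simp
      then have "log H (z b) < log H (H * z a)" using H zpos that by simp
      also have "\<dots> = 1 + log H (z a)" using H zpos[OF that(3)] by (simp add: log_mult)
      finally show ?thesis unfolding \<kappa>_def by linarith
    qed
    have "?X A \<subseteq> (\<Union>i\<in>\<kappa> ` A. ?X (W i))"
    proof safe
      fix j a l b assume m: "j \<in> I" "a \<in> A" "l \<in> I" "b \<in> A" and "\<bar>q (j, a) - q (l, b)\<bar> < 1"
      then have d: "\<bar>real j * z a - real l * z b\<bar> < 1" by (simp add: q_def)
      then have d': "\<bar>real l * z b - real j * z a\<bar> < 1" by linarith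
      have "\<kappa> b \<le> \<kappa> a + 1" "\<kappa> a \<le> \<kappa> b + 1"
        using step[OF m(1,3,2,4) d] step[OF m(3,1,4,2) d'] by auto
      then have "a \<in> W (min (\<kappa> a) (\<kappa> b))" "b \<in> W (min (\<kappa> a) (\<kappa> b))"
        using m by (auto simp: W_def min_def)
      moreover have "min (\<kappa> a) (\<kappa> b) \<in> \<kappa> ` A" using m by (auto simp: min_def)
      ultimately show "((j, a), (l, b)) \<in> (\<Union>i\<in>\<kappa> ` A. ?X (W i))"
        using m d by (intro UN_I[of "min (\<kappa> a) (\<kappa> b)"]) (auto simp: q_def)
    qed
    moreover have "finite (\<Union>i\<in>\<kappa> ` A. ?X (W i))"
      using fin finW by (intro finite_UN_I finite_imageI finite_pairs) (auto simp: I_def)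
    ultimately have "card (?X A) \<le> card (\<Union>i\<in>\<kappa> ` A. ?X (W i))" by (intro card_mono)
    also have "\<dots> \<le> (\<Sum>i\<in>\<kappa> ` A. card (?X (W i)))" using fin by (intro card_UN_le) auto
    finally show ?thesis unfolding near_def .
  qed
  have near2: "(\<Sum>i\<in>\<kappa> ` A. real (near (W i) z r)) \<le> 2 * real (near A z r)" for r
    using sum_windows_le[OF fin, of \<kappa> "\<lambda>a b. \<bar>z a - z b\<bar> < r"]
    unfolding near_def W_def by (simp flip: of_nat_sum)
  have card2: "(\<Sum>i\<in>\<kappa> ` A. (real (card (W i)))\<^sup>2) \<le> 2 * (real (card A))\<^sup>2"
  proof -
    have eq: "(real (card S))\<^sup>2 = real (card {(a, b). a \<in> S \<and> b \<in> S \<and> True})" for S :: "'a set"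
    proof -
      have "{(a, b). a \<in> S \<and> b \<in> S \<and> True} = S \<times> S" by auto
      then show ?thesis by (simp add: card_cartesian_product power2_eq_square)
    qed
    show ?thesis
      using sum_windows_le[OF fin, of \<kappa> "\<lambda>a b. True"]
      unfolding eq W_def by (simp flip: of_nat_sum)
  qed
  have "real (near (I \<times> A) q 1) \<le> (\<Sum>i\<in>\<kappa> ` A. real (near (I \<times> W i) q 1))"
    using cover by (simp flip: of_nat_sum)
  also have "\<dots> \<le> (\<Sum>i\<in>\<kappa> ` A. E * Y i)" by (intro sum_mono window)
  also have "\<dots> = E * (\<Sum>i\<in>\<kappa> ` A. Y i)" by (simp add: sum_distrib_left)
  also have "(\<Sum>i\<in>\<kappa> ` A. Y i) = K\<^sup>2 * (\<Sum>i\<in>\<kappa> ` A. real (near (W i) z (1 / real J))) +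
      D\<^sup>2 / K ^ 4 * (real J ^ 3 * (\<Sum>i\<in>\<kappa> ` A. (real (card (W i)))\<^sup>2) 
        + real J ^ 5 * (\<Sum>i\<in>\<kappa> ` A. real (near (W i) z 1)))"
    by (simp only: Y_def sum.distrib sum_distrib_left[symmetric])
  also have "E * \<dots> \<le> E * (K\<^sup>2 * (2 * real (near A z (1 / real J))) +
      D\<^sup>2 / K ^ 4 * (real J ^ 3 * (2 * (real (card A))\<^sup>2) + real J ^ 5 * (2 * real (near A z 1))))"
    by (intro mult_left_mono add_mono near2 card2 E) auto
  also have "\<dots> = window_const c * (K\<^sup>2 * real (near A z (1 / real J)) +
      D\<^sup>2 / K ^ 4 * (real J ^ 3 * (real (card A))\<^sup>2 + real J ^ 5 * real (near A z 1)))"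
    by (simp add: wc algebra_simps)
  finally show ?thesis by (simp only: I_def q_def)
qed

text \<open>For J <= n use the bound a^2/n^2 and J^k <= n^k; for larger J use 1/J^2, where k <= 4
  makes the remaining power of J work in favour. Blocks below and above N thus obey one
  bound.\<close>

lemma weight_power_le:
  fixes \<sigma> a n J :: real
  assumes "0 \<le> \<sigma>" "\<sigma> \<le> a\<^sup>2 / n\<^sup>2" "\<sigma> \<le> 1 / J\<^sup>2" "n > 0" "J > 0" "k \<le> 4"
  shows "\<sigma>\<^sup>2 * J ^ k \<le> (1 + a ^ 4) / n ^ (4 - k)"
proof (cases "J \<le> n")
  case True
  have "\<sigma>\<^sup>2 * J ^ k \<le> (a\<^sup>2 / n\<^sup>2)\<^sup>2 * n ^ k"
    using assms True by (intro mult_mono power_mono) auto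
  also have "\<dots> = a ^ 4 / n ^ (4 - k)"
    using assms by (simp add: power_divide power_diff flip: power_mult)
  also have "\<dots> \<le> (1 + a ^ 4) / n ^ (4 - k)" using assms by (intro divide_right_mono) auto
  finally show ?thesis .
next
  case False
  have "\<sigma>\<^sup>2 * J ^ k \<le> (1 / J\<^sup>2)\<^sup>2 * J ^ k"
    using assms by (intro mult_mono power_mono) auto
  also have "\<dots> = 1 / J ^ (4 - k)"
    using assms by (simp add: power_divide power_diff flip: power_mult)
  also have "\<dots> \<le> 1 / n ^ (4 - k)" using assms False by (intro divide_left_mono power_mono) auto
  also have "\<dots> \<le> (1 + a ^ 4) / n ^ (4 - k)" using assms by (intro divide_right_mono) auto
  finally show ?thesis .
qed

text \<open>Here \<open>\<sigma>\<close> stands for a bound on the Fourier coefficients of the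
  block. The four resulting terms carry n to the powers -\<delta>/8, -5\<delta>/4, -1 + 5\<delta>/8
  and -3\<delta>/8, of which the first is the largest.\<close>

lemma dyadic_block_le:
  fixes A :: "'a set" and z :: "'a \<Rightarrow> real" and J N :: nat and a c D \<delta> \<sigma> CE CD :: real
  defines "n \<equiv> real N"
  assumes fin: "finite A" and c: "c > 0" and z: "\<And>a. a \<in> A \<Longrightarrow> c \<le> z a"
    and J: "J \<ge> 1" and N: "N \<ge> 1" and \<delta>: "0 < \<delta>" "\<delta> \<le> 1/2"
    and D: "\<And>v. 1 \<le> v \<Longrightarrow> v \<le> 8 * J ^ 3 \<Longrightarrow> real (card {d. d dvd v}) \<le> D"
    and D2: "D\<^sup>2 \<le> CD * n powr (\<delta> / 8)"
    and card: "card A \<le> N\<^sup>2"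
    and E1: "real (near A z (1 / real J)) \<le> CE * (n powr (2 + \<delta> / 8) + n powr (3 - \<delta>) / real J)"
    and E2: "real (near A z 1) \<le> 2 * CE * n powr (3 - \<delta>)"
    and C: "CE \<ge> 0" "CD \<ge> 0"
    and \<sigma>: "0 \<le> \<sigma>" "\<sigma> \<le> a\<^sup>2 / n\<^sup>2" "\<sigma> \<le> 1 / (real J)\<^sup>2"
  shows "\<sigma>\<^sup>2 * real (near ({J..<2*J} \<times> A) (\<lambda>(j, a). real j * z a) 1) \<le>
    window_const c * ((1 + a ^ 4) * (2 * CE + CD * (1 + 2 * CE)) * n powr (- \<delta> / 8))"
proof -
  have n: "n \<ge> 1" using N by (simp add: n_def)
  have wc: "window_const c \<ge> 0" using c by (simp add: window_const_def)
  define j where "j = real J"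
  have j: "j \<ge> 1" using J by (simp add: j_def)
  \<comment> \<open>the threshold \<open>K\<^sup>2 = J N\<^sup>1\<^sup>-\<^sup>\<kappa>\<close> with \<open>\<kappa> = \<delta>/4\<close> makes both halves of the splitting save a power of \<open>N\<close>,
     for \<open>J\<close> below as well as above \<open>N\<close>\<close>
  define P where "P = j * n powr (1 - \<delta> / 4)"
  have P: "P > 0" using j n by (simp add: P_def)
  define K where "K = sqrt P"
  have K: "K > 0" "K\<^sup>2 = P" "K ^ 4 = P\<^sup>2"
  proof -
    show "K > 0" "K\<^sup>2 = P" using P by (simp_all add: K_def)
    then show "K ^ 4 = P\<^sup>2" by (simp flip: \<open>K\<^sup>2 = P\<close> power_mult)
  qed
  have cardn: "(real (card A))\<^sup>2 \<le> n powr 4"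
  proof -
    have "real (card A) \<le> real (N\<^sup>2)" using card by (simp only: of_nat_le_iff)
    then have "(real (card A))\<^sup>2 \<le> (n\<^sup>2)\<^sup>2" by (intro power_mono) (auto simp: n_def)
    also have "\<dots> = n powr 4" using n by (simp flip: power_mult)
    finally show ?thesis .
  qed
  define S where "S = 1 + a ^ 4"
  have S: "S \<ge> 0" by (simp add: S_def)
  \<comment> \<open>Only J^0, J^1 and J^3 occur: the powers J^3 and J^5 of the sixth moment are
    divided by P^2, which contains J^2.\<close>
  have w: "\<sigma>\<^sup>2 \<le> S * n powr (-4)" "\<sigma>\<^sup>2 * j \<le> S * n powr (-3)" "\<sigma>\<^sup>2 * j ^ 3 \<le> S * n powr (-1)"
    using weight_power_le[OF \<sigma>, of 0] weight_power_le[OF \<sigma>, of 1] weight_power_le[OF \<sigma>, of 3] n j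
    by (auto simp: S_def j_def powr_minus divide_inverse)
  have mono: "n powr r \<le> n powr (- \<delta> / 8)" if "r \<le> - \<delta> / 8" for r
    using that n by (intro powr_mono) auto
  let ?m = "n powr (- \<delta> / 8)"
  have T1: "\<sigma>\<^sup>2 * (P * real (near A z (1 / j))) \<le> S * (2 * CE) * ?m"
  proof -
    have "\<sigma>\<^sup>2 * (P * real (near A z (1 / j))) \<le> \<sigma>\<^sup>2 * (P * (CE * (n powr (2 + \<delta> / 8) + n powr (3 - \<delta>) / j)))"
      using E1 P by (intro mult_left_mono) (auto simp: j_def)
    also have "\<dots> = CE * (\<sigma>\<^sup>2 * j * (n powr (1 - \<delta> / 4) * n powr (2 + \<delta> / 8)) + \<sigma>\<^sup>2 * (n powr (1 - \<delta> / 4) * n powr (3 - \<delta>)))"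
      using j by (simp add: P_def field_simps)
    also have "\<dots> \<le> CE * (S * n powr (-3) * (n powr (1 - \<delta> / 4) * n powr (2 + \<delta> / 8)) + 
        S * n powr (-4) * (n powr (1 - \<delta> / 4) * n powr (3 - \<delta>)))"
      using C by (intro mult_left_mono add_mono mult_right_mono w) auto
    also have "\<dots> = CE * (S * n powr (- \<delta> / 8) + S * n powr (- 5 * \<delta> / 4))"
    proof -
      have "n powr (-3) * (n powr (1 - \<delta> / 4) * n powr (2 + \<delta> / 8)) = n powr (- \<delta> / 8)"
        "n powr (-4) * (n powr (1 - \<delta> / 4) * n powr (3 - \<delta>)) = n powr (- 5 * \<delta> / 4)"
        unfolding powr_add[symmetric] by (rule arg_cong[of _ _ "\<lambda>r. n powr r"], simp)+
      then show ?thesis by (simp only: mult.assoc)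
    qed
    also have "\<dots> \<le> CE * (S * ?m + S * ?m)"
      using C S \<delta> by (intro mult_left_mono add_mono mono) auto
    finally show ?thesis by (simp add: algebra_simps)
  qed
  have T2: "\<sigma>\<^sup>2 * (D\<^sup>2 / P\<^sup>2 * (j ^ 3 * (real (card A))\<^sup>2 + j ^ 5 * real (near A z 1))) \<le> S * (CD * (1 + 2 * CE)) * ?m"
  proof -
    have "\<sigma>\<^sup>2 * (D\<^sup>2 / P\<^sup>2 * (j ^ 3 * (real (card A))\<^sup>2 + j ^ 5 * real (near A z 1))) \<le>
      \<sigma>\<^sup>2 * (CD * n powr (\<delta> / 8) / P\<^sup>2 * (j ^ 3 * n powr 4 + j ^ 5 * (2 * CE * n powr (3 - \<delta>))))"
      using j C by (intro mult_left_mono mult_mono divide_right_mono add_mono D2 cardn E2) auto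
    also have "\<dots> = CD * (n powr (\<delta> / 8) * inverse (n powr (1 - \<delta> / 4))^2 * 
        (\<sigma>\<^sup>2 * j * n powr 4 + \<sigma>\<^sup>2 * j ^ 3 * (2 * CE * n powr (3 - \<delta>))))"
      using j n by (simp add: P_def field_simps power_numeral_reduce)
    also have "inverse (n powr (1 - \<delta> / 4))^2 = n powr (- 2 + \<delta> / 2)"
    proof -
      have "inverse (n powr (1 - \<delta> / 4))^2 = n powr (- (1 - \<delta> / 4)) * n powr (- (1 - \<delta> / 4))"
        by (simp only: powr_minus power2_eq_square)
      also have "\<dots> = n powr (- 2 + \<delta> / 2)"
        unfolding powr_add[symmetric] by (rule arg_cong[of _ _ "\<lambda>r. n powr r"]) simp
      finally show ?thesis .
    qed
    also have "CD * (n powr (\<delta> / 8) * n powr (- 2 + \<delta> / 2) * 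
        (\<sigma>\<^sup>2 * j * n powr 4 + \<sigma>\<^sup>2 * j ^ 3 * (2 * CE * n powr (3 - \<delta>)))) \<le>
      CD * (n powr (\<delta> / 8) * n powr (- 2 + \<delta> / 2) * 
        (S * n powr (-3) * n powr 4 + S * n powr (-1) * (2 * CE * n powr (3 - \<delta>))))"
      using C by (intro mult_left_mono add_mono mult_right_mono w) auto
    also have "\<dots> = CD * S * (n powr (\<delta> / 8) * (n powr (- 2 + \<delta> / 2) * (n powr (-3) * n powr 4)) + 
        2 * CE * (n powr (\<delta> / 8) * (n powr (- 2 + \<delta> / 2) * (n powr (-1) * n powr (3 - \<delta>)))))"
      by (simp add: algebra_simps)
    also have "\<dots> = CD * S * (n powr (- 1 + 5 * \<delta> / 8) + 2 * CE * n powr (- 3 * \<delta> / 8))"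
    proof -
      have "n powr (\<delta> / 8) * (n powr (- 2 + \<delta> / 2) * (n powr (-3) * n powr 4)) = n powr (- 1 + 5 * \<delta> / 8)"
        "n powr (\<delta> / 8) * (n powr (- 2 + \<delta> / 2) * (n powr (-1) * n powr (3 - \<delta>))) = n powr (- 3 * \<delta> / 8)"
        unfolding powr_add[symmetric] by (rule arg_cong[of _ _ "\<lambda>r. n powr r"], simp)+
      then show ?thesis by (simp only:)
    qed
    also have "\<dots> \<le> CD * S * (?m + 2 * CE * ?m)"
      using C S \<delta> by (intro mult_left_mono add_mono mono) auto
    finally show ?thesis by (simp add: algebra_simps)
  qed
  have "\<sigma>\<^sup>2 * real (near ({J..<2*J} \<times> A) (\<lambda>(j, a). real j * z a) 1) \<le> 
     \<sigma>\<^sup>2 * (window_const c * (P * real (near A z (1 / j)) +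
      D\<^sup>2 / P\<^sup>2 * (j ^ 3 * (real (card A))\<^sup>2 + j ^ 5 * real (near A z 1))))"
    using near_dyadic_le[OF fin c z J K(1) D] unfolding K j_def[symmetric]
    by (intro mult_left_mono) auto
  also have "\<dots> = window_const c * (\<sigma>\<^sup>2 * (P * real (near A z (1 / j))) +
      \<sigma>\<^sup>2 * (D\<^sup>2 / P\<^sup>2 * (j ^ 3 * (real (card A))\<^sup>2 + j ^ 5 * real (near A z 1))))"
    by (simp only: distrib_left mult.left_commute)
  also have "\<dots> \<le> window_const c * (S * (2 * CE) * ?m + S * (CD * (1 + 2 * CE)) * ?m)"
    by (intro mult_left_mono add_mono T1 T2 wc)
  also have "\<dots> = window_const c * (S * (2 * CE + CD * (1 + 2 * CE)) * ?m)"
    by (simp only: distrib_left distrib_right)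
  finally show ?thesis by (simp only: S_def)
qed

subsection \<open>Variance of the triangle statistic\<close>

text \<open>Restricting to m < n makes the gaps positive, so that they have logarithms; by symmetry
  the other pairs only contribute a factor 2.\<close>

definition index_pairs :: "nat \<Rightarrow> (nat \<times> nat) set" where
  "index_pairs N = {(m, n). 1 \<le> m \<and> m < n \<and> n \<le> N}"

definition gap :: "(nat \<Rightarrow> real) \<Rightarrow> nat \<times> nat \<Rightarrow> real" where
  "gap x = (\<lambda>(m, n). x n - x m)"

lemma finite_index_pairs [simp]: "finite (index_pairs N)"
  by (rule finite_subset[of _ "{0..N} \<times> {0..N}"]) (auto simp: index_pairs_def)

lemma card_index_pairs_le: "card (index_pairs N) \<le> N\<^sup>2"
proof -
  have "card (index_pairs N) \<le> card ({1..N} \<times> {1..N})"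
    by (intro card_mono) (auto simp: index_pairs_def)
  then show ?thesis by (simp add: card_cartesian_product power2_eq_square)
qed

text \<open>Since (x n - x m) - (x n' - x m') = x n - x m + x m' - x n', two index pairs inject into
  the quadruples in the order n, m, m', n'.\<close>

lemma near_index_pairs_le_energy: "near (index_pairs N) (gap x) \<gamma> \<le> energy x N \<gamma>"
proof -
  let ?X = "{(p, q). p \<in> index_pairs N \<and> q \<in> index_pairs N \<and> \<bar>gap x p - gap x q\<bar> < \<gamma>}"
  let ?Y = "{(n1, n2, n3, n4). n1 \<in> {1..N} \<and> n2 \<in> {1..N} \<and> n3 \<in> {1..N} \<and> n4 \<in> {1..N} \<and>
     \<bar>x n1 - x n2 + x n3 - x n4\<bar> < \<gamma>}"
  let ?f = "\<lambda>((m, n), (m', n')). (n, m, m', n' :: nat)"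
  have "finite ?Y"
    by (rule finite_subset[of _ "{1..N} \<times> {1..N} \<times> {1..N} \<times> {1..N}"]) auto
  moreover have "inj_on ?f ?X" by (auto simp: inj_on_def)
  moreover have "?f ` ?X \<subseteq> ?Y"
    by (auto simp: index_pairs_def gap_def algebra_simps)
  ultimately show ?thesis unfolding near_def energy_def by (intro card_inj_on_le)
qed

lemma gap_ge:
  assumes "c > 0" "\<forall>n\<ge>1. x (n + 1) - x n \<ge> c" "p \<in> index_pairs N"
  shows "c \<le> gap x p"
proof -
  obtain m n where p: "p = (m, n)" "1 \<le> m" "m < n" using assms(3) by (auto simp: index_pairs_def)
  have "c \<le> x (m + Suc k) - x m" for k
  proof (induction k)
    case 0
    then show ?case using assms(2) p by simp
  next
    case (Suc k)
    have "c \<le> x (m + Suc k + 1) - x (m + Suc k)" using assms(2) by simp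
    then show ?case using Suc assms(1) by simp
  qed
  from this[of "n - m - 1"] show ?thesis using p by (simp add: gap_def)
qed

text \<open>Half the cosine coefficient, that is, the coefficient of e^(2 pi i j t), in the Fourier
  series of the triangle of half-width \<open>b\<close>.\<close>

definition tri_coeff :: "real \<Rightarrow> nat \<Rightarrow> real" where
  "tri_coeff b j = (sin (pi * b * real j) / (pi * real j))\<^sup>2"

lemma tri_coeff_nonneg: "0 \<le> tri_coeff b j"
  by (simp add: tri_coeff_def)

lemma tri_coeff_le:
  assumes "j \<ge> 1"
  shows "tri_coeff b j \<le> b\<^sup>2" "tri_coeff b j \<le> 1 / (real j)\<^sup>2"
proof -
  have j: "real j > 0" using assms by simp
  have "\<bar>sin (pi * b * real j)\<bar> \<le> \<bar>pi * b * real j\<bar>" by (rule abs_sin_x_le_abs_x)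
  then have "\<bar>sin (pi * b * real j) / (pi * real j)\<bar> \<le> \<bar>b\<bar>"
    using j by (simp add: abs_mult abs_divide field_simps)
  then show "tri_coeff b j \<le> b\<^sup>2" unfolding tri_coeff_def by (rule abs_le_square_iff[THEN iffD1])
  have "\<bar>sin (pi * b * real j) / (pi * real j)\<bar> \<le> 1 / (1 * real j)"
    unfolding abs_divide using j pi_ge_two by (intro frac_le mult_right_mono) auto
  then have "\<bar>sin (pi * b * real j) / (pi * real j)\<bar> \<le> \<bar>1 / real j\<bar>" by simp
  then have "tri_coeff b j \<le> (1 / real j)\<^sup>2" unfolding tri_coeff_def by (rule abs_le_square_iff[THEN iffD1])
  then show "tri_coeff b j \<le> 1 / (real j)\<^sup>2" by (simp add: power_divide)
qed

text \<open>The nonconstant part of the Fourier series, summed over the gaps and cut off at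
  frequency 2^M; without the factor 2 of the cosine coefficients.\<close>

definition tri_fluct :: "(nat \<Rightarrow> real) \<Rightarrow> real \<Rightarrow> nat \<Rightarrow> nat \<Rightarrow> real \<Rightarrow> real" where
  "tri_fluct x a N M \<alpha> =
     (\<Sum>j\<in>{1..<2^M}. \<Sum>p\<in>index_pairs N. tri_coeff (a / real N) j * cos (2 * pi * real j * (gap x p * \<alpha>)))"

definition tri_block :: "(nat \<Rightarrow> real) \<Rightarrow> real \<Rightarrow> nat \<Rightarrow> nat \<Rightarrow> real \<Rightarrow> complex" where
  "tri_block x a N J = expsum ({J..<2*J} \<times> index_pairs N) (\<lambda>(j, p). tri_coeff (a / real N) j)
     (\<lambda>(j, p). 2 * pi * (real j * gap x p))"

lemma sum_dyadic_blocks: "(\<Sum>j\<in>{1..<2^M}. f j) = (\<Sum>i<M. \<Sum>j\<in>{2^i..<2*2^i::nat}. f j :: real)"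
proof (induction M)
  case (Suc M)
  have "(\<Sum>j\<in>{1..<2^Suc M}. f j) = (\<Sum>j\<in>{1..<2^M}. f j) + (\<Sum>j\<in>{2^M..<2*2^M}. f j)"
    by (subst sum.atLeastLessThan_concat) auto
  then show ?case using Suc by simp
qed simp

lemma tri_fluct_eq: "tri_fluct x a N M \<alpha> = Re (\<Sum>i<M. tri_block x a N (2^i) \<alpha>)"
  unfolding tri_fluct_def sum_dyadic_blocks
  by (simp add: tri_block_def expsum_def sum.cartesian_product case_prod_unfold mult_ac)

text \<open>Cauchy--Schwarz over the dyadic blocks costs only M, which is logarithmic in N and
  dominated by the power saved in each block.\<close>

lemma tri_fluct_square_le:
  "(tri_fluct x a N M \<alpha>)\<^sup>2 \<le> real M * (\<Sum>i<M. (norm (tri_block x a N (2^i) \<alpha>))\<^sup>2)"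
proof -
  have "\<bar>tri_fluct x a N M \<alpha>\<bar> \<le> norm (\<Sum>i<M. tri_block x a N (2^i) \<alpha>)"
    unfolding tri_fluct_eq by (rule abs_Re_le_cmod)
  also have "\<dots> \<le> (\<Sum>i<M. norm (tri_block x a N (2^i) \<alpha>))" by (rule norm_sum)
  finally have "\<bar>tri_fluct x a N M \<alpha>\<bar>\<^sup>2 \<le> (\<Sum>i<M. norm (tri_block x a N (2^i) \<alpha>))\<^sup>2"
    by (rule power_mono) simp
  also have "\<dots> \<le> (\<Sum>i<M. (norm (tri_block x a N (2^i) \<alpha>))\<^sup>2) * real (card {..<M})"
    by (rule sum_squared_le_sum_of_squares)
  finally show ?thesis by (simp add: mult.commute)
qed

lemma integrable_norm_tri_block_square:
  "integrable std_normal_distribution (\<lambda>\<alpha>. (norm (tri_block x a N J \<alpha>))\<^sup>2)"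
  unfolding tri_block_def by (rule integrable_norm_expsum_power) (auto simp: tri_coeff_nonneg)

lemma integrable_tri_fluct_square:
  "integrable std_normal_distribution (\<lambda>\<alpha>. (tri_fluct x a N M \<alpha>)\<^sup>2)"
proof (rule integrable_std_normal_bounded)
  show "continuous_on UNIV (\<lambda>\<alpha>. (tri_fluct x a N M \<alpha>)\<^sup>2)"
    unfolding tri_fluct_def by (intro continuous_intros)
  have "\<bar>tri_fluct x a N M \<alpha>\<bar> \<le> (\<Sum>j\<in>{1..<2^M}. \<Sum>p\<in>index_pairs N. tri_coeff (a / real N) j)" for \<alpha>
    unfolding tri_fluct_def
    by (intro order_trans[OF sum_abs] sum_mono)
       (auto simp: abs_mult tri_coeff_nonneg intro!: mult_left_le)
  then have "\<bar>tri_fluct x a N M \<alpha>\<bar>\<^sup>2 \<le> (\<Sum>j\<in>{1..<2^M}. \<Sum>p\<in>index_pairs N. tri_coeff (a / real N) j)\<^sup>2" for \<alpha>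
    by (rule power_mono) simp
  then show "\<bar>(tri_fluct x a N M \<alpha>)\<^sup>2\<bar> \<le> (\<Sum>j\<in>{1..<2^M}. \<Sum>p\<in>index_pairs N. tri_coeff (a / real N) j)\<^sup>2" for \<alpha>
    by simp
qed

lemma integral_tri_fluct_square_le:
  "(\<integral>\<alpha>. (tri_fluct x a N M \<alpha>)\<^sup>2 \<partial>std_normal_distribution) \<le>
     real M * (\<Sum>i<M. \<integral>\<alpha>. (norm (tri_block x a N (2^i) \<alpha>))\<^sup>2 \<partial>std_normal_distribution)"
proof -
  have "(\<integral>\<alpha>. (tri_fluct x a N M \<alpha>)\<^sup>2 \<partial>std_normal_distribution) \<le>
     (\<integral>\<alpha>. real M * (\<Sum>i<M. (norm (tri_block x a N (2^i) \<alpha>))\<^sup>2) \<partial>std_normal_distribution)"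
    by (intro integral_mono integrable_tri_fluct_square integrable_mult_right
        Bochner_Integration.integrable_sum integrable_norm_tri_block_square tri_fluct_square_le)
  also have "\<dots> = real M * (\<Sum>i<M. \<integral>\<alpha>. (norm (tri_block x a N (2^i) \<alpha>))\<^sup>2 \<partial>std_normal_distribution)"
    by (simp add: Bochner_Integration.integral_sum integrable_norm_tri_block_square)
  finally show ?thesis .
qed

text \<open>Coefficients and Gaussian values are nonnegative, so each coefficient may be replaced by
  \<open>\<sigma>\<close>. The factor 2 pi in the phases exceeds 1, so removing it only enlarges the
  count.\<close>

lemma integral_tri_block_square_le:
  assumes J: "J \<ge> 1" and \<sigma>: "\<And>j. j \<ge> J \<Longrightarrow> tri_coeff (a / real N) j \<le> \<sigma>"
  shows "(\<integral>\<alpha>. (norm (tri_block x a N J \<alpha>))\<^sup>2 \<partial>std_normal_distribution) \<le>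
    18 * (\<sigma>\<^sup>2 * real (near ({J..<2*J} \<times> index_pairs N) (\<lambda>(j, p). real j * gap x p) 1))"
proof -
  let ?U = "{J..<2*J} \<times> index_pairs N"
  let ?q = "\<lambda>(j, p). real j * gap x p"
  let ?q' = "\<lambda>(j, p). 2 * pi * (real j * gap x p)"
  let ?v = "\<lambda>(j, p). tri_coeff (a / real N) j :: real"
  have finU: "finite ?U" by simp
  have "(\<integral>\<alpha>. (norm (tri_block x a N J \<alpha>))\<^sup>2 \<partial>std_normal_distribution) =
      (\<Sum>r\<in>?U. \<Sum>s\<in>?U. ?v r * ?v s * gauss (?q' r - ?q' s))"
    unfolding tri_block_def by (rule integral_norm_expsum_square)
  also have "\<dots> \<le> (\<Sum>r\<in>?U. \<Sum>s\<in>?U. \<sigma>\<^sup>2 * gauss (?q' r - ?q' s))"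
  proof (intro sum_mono mult_right_mono)
    fix r s assume rs: "r \<in> ?U" "s \<in> ?U"
    have "0 \<le> ?v r" "0 \<le> ?v s" "?v r \<le> \<sigma>" "?v s \<le> \<sigma>"
      using rs \<sigma> by (auto simp: tri_coeff_nonneg split: prod.splits)
    then have "?v r * ?v s \<le> \<sigma> * \<sigma>" by (intro mult_mono) auto
    then show "?v r * ?v s \<le> \<sigma>\<^sup>2" by (simp only: power2_eq_square)
  qed simp
  also have "\<dots> = \<sigma>\<^sup>2 * (\<Sum>r\<in>?U. \<Sum>s\<in>?U. gauss (?q' r - ?q' s))"
    by (simp only: sum_distrib_left)
  also have "\<dots> \<le> \<sigma>\<^sup>2 * (18 * real (near ?U ?q' 1))"
    by (intro mult_left_mono sum_gauss_le_near finU) simp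
  also have "\<dots> \<le> \<sigma>\<^sup>2 * (18 * real (near ?U ?q 1))"
  proof -
    have "near ?U ?q' 1 \<le> near ?U ?q 1"
      unfolding near_def
    proof (rule card_mono[OF finite_pairs[OF finU]], safe)
      fix j m n l m' n'
      assume *: "\<bar>2 * pi * (real j * gap x (m, n)) - 2 * pi * (real l * gap x (m', n'))\<bar> < 1"
      define d where "d = real j * gap x (m, n) - real l * gap x (m', n')"
      have "1 * \<bar>d\<bar> \<le> (2 * pi) * \<bar>d\<bar>" using pi_ge_two by (intro mult_right_mono) auto
      also have "\<dots> = \<bar>2 * pi * (real j * gap x (m, n)) - 2 * pi * (real l * gap x (m', n'))\<bar>"
        unfolding right_diff_distrib[symmetric] d_def[symmetric] by (simp add: abs_mult)
      finally show "\<bar>real j * gap x (m, n) - real l * gap x (m', n')\<bar> < 1"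
        using * by (simp add: d_def)
    qed
    then show ?thesis by (intro mult_left_mono) auto
  qed
  finally show ?thesis by (simp only: mult.left_commute)
qed

text \<open>The exponent \<open>\<kappa>\<close> is chosen before the width \<open>a\<close>, so
  that a single exponent q will later serve for all widths.\<close>

lemma tri_fluct_variance:
  fixes x :: "nat \<Rightarrow> real"
  assumes gap: "\<exists>c>0. \<forall>n\<ge>1. x (n + 1) - x n \<ge> c"
    and en: "\<exists>\<delta>>0. \<forall>\<eta>>0. \<exists>C>0. \<forall>\<^sub>F N in sequentially. \<forall>\<gamma>\<in>{0<..1}.
           real (energy x N \<gamma>) \<le> C * (real N powr (2 + \<eta>) + \<gamma> * real N powr (3 - \<delta>))"
  shows "\<exists>\<kappa>>0. \<forall>a. \<exists>C. \<forall>\<^sub>F N in sequentially. \<forall>M. 2 ^ M \<le> 2 * N ^ 3 \<longrightarrow>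
     (\<integral>\<alpha>. (tri_fluct x a N M \<alpha>)\<^sup>2 \<partial>std_normal_distribution) \<le> C * real N powr (- \<kappa>)"
proof -
  obtain c where c: "c > 0" "\<forall>n\<ge>1. x (n + 1) - x n \<ge> c" using gap by blast
  obtain \<delta>0 where \<delta>0: "\<delta>0 > 0" and en0: "\<And>\<eta>. \<eta> > 0 \<Longrightarrow> \<exists>C>0. \<forall>\<^sub>F N in sequentially. \<forall>\<gamma>\<in>{0<..1}.
           real (energy x N \<gamma>) \<le> C * (real N powr (2 + \<eta>) + \<gamma> * real N powr (3 - \<delta>0))"
    using en by blast
  define \<delta> where "\<delta> = min \<delta>0 (1/2)"
  have \<delta>: "0 < \<delta>" "\<delta> \<le> 1/2" "\<delta> \<le> \<delta>0" using \<delta>0 by (auto simp: \<delta>_def)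
  obtain CE where CE: "CE > 0" and enCE: "\<forall>\<^sub>F N in sequentially. \<forall>\<gamma>\<in>{0<..1}.
           real (energy x N \<gamma>) \<le> CE * (real N powr (2 + \<delta> / 8) + \<gamma> * real N powr (3 - \<delta>0))"
    using en0[of "\<delta> / 8"] \<delta> by auto
  \<comment> \<open>The divisor bound is applied to integers up to 8 J^3 <= 8 N^9; 9 \<epsilon> =
    \<delta>/16 makes D^2 of size N^(\<delta>/8).\<close>
  define \<epsilon> where "\<epsilon> = \<delta> / 144"
  obtain Cd where Cd: "Cd \<ge> 1" "\<And>n. n \<ge> 1 \<Longrightarrow> real (card {d. d dvd n}) \<le> Cd * real n powr \<epsilon>"
    using divisor_bound[of \<epsilon>] \<delta> by (auto simp: \<epsilon>_def)
  define CD where "CD = (Cd * 8 powr \<epsilon>)\<^sup>2"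
  define B where "B a = 18 * (window_const c * ((1 + a ^ 4) * (2 * CE + CD * (1 + 2 * CE))))" for a
  have wc: "window_const c \<ge> 0" using c by (simp add: window_const_def)
  have B: "B a \<ge> 0" for a using wc CE by (simp add: B_def CD_def)
  \<comment> \<open>M enters twice, through Cauchy--Schwarz and as the number of blocks, and M <= 1
    + 3 log N to base 2. Half of the saving \<delta>/8 pays for M^2.\<close>
  have log: "\<forall>\<^sub>F N in sequentially. (1 + 3 * log 2 (real N))\<^sup>2 \<le> real N powr (\<delta> / 16)"
    using \<delta>(1) by real_asymp
  have "\<forall>\<^sub>F N in sequentially. \<forall>M. 2 ^ M \<le> 2 * N ^ 3 \<longrightarrow>
     (\<integral>\<alpha>. (tri_fluct x a N M \<alpha>)\<^sup>2 \<partial>std_normal_distribution) \<le> B a * real N powr (- (\<delta> / 16))" for a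
    using enCE log eventually_ge_at_top[of 1]
  proof (eventually_elim, intro allI impI)
    fix N M :: nat
    assume enN: "\<forall>\<gamma>\<in>{0<..1}. real (energy x N \<gamma>) \<le> CE * (real N powr (2 + \<delta> / 8) + \<gamma> * real N powr (3 - \<delta>0))"
      and logN: "(1 + 3 * log 2 (real N))\<^sup>2 \<le> real N powr (\<delta> / 16)" and N: "1 \<le> N"
      and M: "2 ^ M \<le> 2 * N ^ 3"
    define n where "n = real N"
    have n: "n \<ge> 1" using N by (simp add: n_def)
    define D where "D = Cd * (8 * n ^ 9) powr \<epsilon>"
    have D2: "D\<^sup>2 \<le> CD * n powr (\<delta> / 8)"
    proof -
      have "(8 * n ^ 9) powr \<epsilon> = 8 powr \<epsilon> * (n powr 9) powr \<epsilon>" using n by (simp add: powr_mult)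
      also have "(n powr 9) powr \<epsilon> = n powr (\<delta> / 16)" by (simp add: powr_powr \<epsilon>_def)
      finally have "D\<^sup>2 = CD * (n powr (\<delta> / 16))\<^sup>2" by (simp add: D_def CD_def power_mult_distrib)
      also have "(n powr (\<delta> / 16))\<^sup>2 = n powr (\<delta> / 8)" by (simp add: power2_eq_square flip: powr_add)
      finally show ?thesis by simp
    qed
    have E: "real (near (index_pairs N) (gap x) \<gamma>) \<le> CE * (n powr (2 + \<delta> / 8) + \<gamma> * n powr (3 - \<delta>))"
      if "0 < \<gamma>" "\<gamma> \<le> 1" for \<gamma>
    proof -
      have "real (near (index_pairs N) (gap x) \<gamma>) \<le> real (energy x N \<gamma>)"
        using near_index_pairs_le_energy[of N x \<gamma>] by (simp only: of_nat_le_iff)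
      also have "\<dots> \<le> CE * (n powr (2 + \<delta> / 8) + \<gamma> * n powr (3 - \<delta>0))"
        using enN that by (simp add: n_def)
      also have "\<dots> \<le> CE * (n powr (2 + \<delta> / 8) + \<gamma> * n powr (3 - \<delta>))"
        using CE that n \<delta> by (intro mult_left_mono add_left_mono powr_mono) auto
      finally show ?thesis .
    qed
    have block: "(\<integral>\<alpha>. (norm (tri_block x a N (2^i) \<alpha>))\<^sup>2 \<partial>std_normal_distribution) \<le> B a * n powr (- \<delta> / 8)"
      if i: "i < M" for i
    proof -
      define J where "J = (2::nat) ^ i"
      have J: "J \<ge> 1" by (simp add: J_def)
      have JN: "J \<le> N ^ 3"
      proof -
        have "2 * J = 2 ^ Suc i" by (simp add: J_def)
        also have "\<dots> \<le> 2 ^ M" using i by (intro power_increasing) auto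
        also have "\<dots> \<le> 2 * N ^ 3" by (rule M)
        finally show ?thesis by simp
      qed
      have D: "real (card {d. d dvd v}) \<le> D" if "1 \<le> v" "v \<le> 8 * J ^ 3" for v
      proof -
        have "v \<le> 8 * (N ^ 3) ^ 3" using that(2) power_mono[OF JN, of 3] by simp
        then have "real v \<le> real (8 * (N ^ 3) ^ 3)" by (simp only: of_nat_le_iff)
        then have "real v \<le> 8 * n ^ 9" by (simp add: n_def flip: power_mult)
        then have "real v powr \<epsilon> \<le> (8 * n ^ 9) powr \<epsilon>"
          using \<delta> by (intro powr_mono2) (auto simp: \<epsilon>_def)
        then have "Cd * real v powr \<epsilon> \<le> D" unfolding D_def using Cd by (intro mult_left_mono) auto
        then show ?thesis using Cd(2)[OF that(1)] by linarith
      qed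
      define \<sigma> where "\<sigma> = min (a\<^sup>2 / n\<^sup>2) (1 / (real J)\<^sup>2)"
      have \<sigma>: "0 \<le> \<sigma>" "\<sigma> \<le> a\<^sup>2 / n\<^sup>2" "\<sigma> \<le> 1 / (real J)\<^sup>2" by (auto simp: \<sigma>_def)
      have coeff: "tri_coeff (a / real N) j \<le> \<sigma>" if "j \<ge> J" for j
      proof -
        have j: "j \<ge> 1" using that J by simp
        have "tri_coeff (a / real N) j \<le> (a / real N)\<^sup>2" by (rule tri_coeff_le(1)[OF j])
        moreover have "tri_coeff (a / real N) j \<le> 1 / (real j)\<^sup>2" by (rule tri_coeff_le(2)[OF j])
        moreover have "1 / (real j)\<^sup>2 \<le> 1 / (real J)\<^sup>2"
          using that J by (intro divide_left_mono power_mono) auto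
        ultimately show ?thesis by (simp add: \<sigma>_def n_def power_divide)
      qed
      have E1: "real (near (index_pairs N) (gap x) (1 / real J)) \<le>
          CE * (n powr (2 + \<delta> / 8) + n powr (3 - \<delta>) / real J)"
        using E[of "1 / real J"] J by simp
      have E2: "real (near (index_pairs N) (gap x) 1) \<le> 2 * CE * n powr (3 - \<delta>)"
      proof -
        have "n powr (2 + \<delta> / 8) \<le> n powr (3 - \<delta>)" using n \<delta> by (intro powr_mono) auto
        then have "CE * (n powr (2 + \<delta> / 8) + 1 * n powr (3 - \<delta>)) \<le> CE * (n powr (3 - \<delta>) + 1 * n powr (3 - \<delta>))"
          using CE by (intro mult_left_mono add_right_mono) auto
        then show ?thesis using E[of 1] by simp
      qed
      have "(\<integral>\<alpha>. (norm (tri_block x a N J \<alpha>))\<^sup>2 \<partial>std_normal_distribution) \<le>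
        18 * (\<sigma>\<^sup>2 * real (near ({J..<2*J} \<times> index_pairs N) (\<lambda>(j, p). real j * gap x p) 1))"
        by (rule integral_tri_block_square_le[OF J coeff])
      also have "\<dots> \<le> 18 * (window_const c * ((1 + a ^ 4) * (2 * CE + CD * (1 + 2 * CE)) * n powr (- \<delta> / 8)))"
        using dyadic_block_le[where CD = CD and CE = CE and \<sigma> = \<sigma> and a = a and D = D,
            OF finite_index_pairs c(1) gap_ge[OF c] J N \<delta>(1,2) D, of N]
          D2 card_index_pairs_le E1 E2 CE \<sigma>
        by (intro mult_left_mono) (auto simp: n_def CD_def)
      finally show ?thesis by (simp only: J_def B_def mult.assoc)
    qed
    have M2: "(real M)\<^sup>2 \<le> n powr (\<delta> / 16)"
    proof -
      have "real (2 ^ M) \<le> real (2 * N ^ 3)" using M by (simp only: of_nat_le_iff)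
      then have "2 powr real M \<le> 2 * n ^ 3" by (simp add: n_def powr_realpow)
      then have "real M \<le> log 2 (2 * n ^ 3)" using n by (subst le_log_iff) auto
      also have "\<dots> = 1 + 3 * log 2 n" using n by (simp add: log_mult log_nat_power)
      finally have "(real M)\<^sup>2 \<le> (1 + 3 * log 2 n)\<^sup>2" by (intro power_mono) auto
      then show ?thesis using logN by (simp add: n_def)
    qed
    have "(\<integral>\<alpha>. (tri_fluct x a N M \<alpha>)\<^sup>2 \<partial>std_normal_distribution) \<le>
      real M * (\<Sum>i<M. \<integral>\<alpha>. (norm (tri_block x a N (2^i) \<alpha>))\<^sup>2 \<partial>std_normal_distribution)"
      by (rule integral_tri_fluct_square_le)
    also have "\<dots> \<le> real M * (\<Sum>i<M. B a * n powr (- \<delta> / 8))"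
      by (intro mult_left_mono sum_mono block) auto
    also have "\<dots> = (real M)\<^sup>2 * (B a * n powr (- \<delta> / 8))" by (simp add: power2_eq_square)
    also have "\<dots> \<le> n powr (\<delta> / 16) * (B a * n powr (- \<delta> / 8))"
      using B by (intro mult_right_mono M2) auto
    also have "\<dots> = B a * (n powr (\<delta> / 16) * n powr (- \<delta> / 8))" by (simp only: mult.left_commute)
    also have "n powr (\<delta> / 16) * n powr (- \<delta> / 8) = n powr (- (\<delta> / 16))"
      unfolding powr_add[symmetric] by (rule arg_cong[of _ _ "\<lambda>r. n powr r"]) simp
    finally show "(\<integral>\<alpha>. (tri_fluct x a N M \<alpha>)\<^sup>2 \<partial>std_normal_distribution) \<le> B a * real N powr (- (\<delta> / 16))"
      by (simp only: n_def)
  qed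
  moreover have "\<delta> / 16 > 0" using \<delta> by simp
  ultimately show ?thesis by blast
qed

subsection \<open>Almost sure convergence\<close>

lemma card_index_pairs: "real (card (index_pairs N)) = real N * (real N - 1) / 2"
proof (induction N)
  case 0
  have "index_pairs 0 = {}" by (auto simp: index_pairs_def)
  then show ?case by simp
next
  case (Suc N)
  have "index_pairs (Suc N) = index_pairs N \<union> (\<lambda>m. (m, Suc N)) ` {1..N}"
    by (auto simp: index_pairs_def)
  moreover have "index_pairs N \<inter> (\<lambda>m. (m, Suc N)) ` {1..N} = {}" by (auto simp: index_pairs_def)
  ultimately have "card (index_pairs (Suc N)) = card (index_pairs N) + N"
    by (simp add: card_Un_disjoint card_image inj_on_def)
  then show ?case using Suc by (simp add: field_simps)
qed

definition tri_count :: "(nat \<Rightarrow> real) \<Rightarrow> real \<Rightarrow> nat \<Rightarrow> real \<Rightarrow> real" where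
  "tri_count x a N \<alpha> = (\<Sum>p\<in>index_pairs N. max 0 (a / real N - dist_int (gap x p * \<alpha>)))"

text \<open>The discarded terms are at most 2/(j (j + 1)), which telescopes from j = R - 1 to 2/(R -
  1) <= 4/R.\<close>

lemma triangle_partial_sum_error:
  assumes b: "0 \<le> b" "b \<le> 1/2" and R: "R \<ge> 2"
  shows "\<bar>max 0 (b - dist_int t) - b\<^sup>2 - (\<Sum>j\<in>{1..<R}. 2 * tri_coeff b j * cos (2 * pi * real j * t))\<bar>
    \<le> 4 / real R"
proof -
  define f where "f n = 2 * tri_coeff b (Suc n) * cos (2 * pi * real (Suc n) * t)" for n
  have f: "f sums (max 0 (b - dist_int t) - b\<^sup>2)"
    using triangle_fourier_sums[OF b, of t] by (simp add: f_def[abs_def] tri_coeff_def)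
  have S: "(\<Sum>j\<in>{1..<R}. 2 * tri_coeff b j * cos (2 * pi * real j * t)) = (\<Sum>n<R - 1. f n)"
    by (rule sum.reindex_bij_witness[of _ Suc "\<lambda>j. j - 1"]) (auto simp: f_def)
  define h where "h n = 2 / real (n + (R - 1))" for n
  have "h \<longlonglongrightarrow> 0" unfolding h_def by real_asymp
  then have tel: "(\<lambda>n. h n - h (Suc n)) sums (h 0 - 0)" by (rule telescope_sums')
  have "norm (max 0 (b - dist_int t) - b\<^sup>2 - (\<Sum>n<R - 1. f n)) \<le> h 0 - 0"
  proof (rule norm_sums_le[OF sums_split_initial_segment[OF f] tel])
    fix n
    define j where "j = n + (R - 1)"
    have j: "real j > 0" using R by (simp add: j_def)
    have "norm (f j) \<le> 2 * tri_coeff b (Suc j) * 1"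
      unfolding f_def real_norm_def abs_mult by (intro mult_mono) (auto simp: tri_coeff_nonneg)
    also have "\<dots> \<le> 2 * (1 / (real (Suc j))\<^sup>2)" using tri_coeff_le(2)[of "Suc j" b] by simp
    also have "\<dots> \<le> 2 * (1 / (real j * real (Suc j)))"
      using j by (intro mult_left_mono divide_left_mono) (auto simp: power2_eq_square)
    also have "\<dots> = 2 / real j - 2 / real (Suc j)" using j by (simp add: field_simps)
    also have "\<dots> = h n - h (Suc n)" by (simp add: h_def j_def)
    finally show "norm (f (n + (R - 1))) \<le> h n - h (Suc n)" by (simp only: j_def)
  qed
  also have "h 0 - 0 \<le> 4 / real R" using R by (simp add: h_def of_nat_diff field_simps)
  finally show ?thesis unfolding S by simp
qed

text \<open>Cutting at frequency 2^M >= N^3 costs at most 4/N^3 for each of at most N^2 pairs. The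
  main term a^2 (1 - 1/N) is twice the number of pairs times the mean (a/N)^2 of the
  triangle.\<close>

lemma tri_count_approx:
  assumes a: "0 \<le> a" "2 * a \<le> real N" and M: "N ^ 3 \<le> 2 ^ M" and N: "N \<ge> 2"
  shows "\<bar>2 * tri_count x a N \<alpha> - a\<^sup>2 * (1 - 1 / real N) - 4 * tri_fluct x a N M \<alpha>\<bar> \<le> 8 / real N"
proof -
  define b where "b = a / real N"
  have b: "0 \<le> b" "b \<le> 1/2" using a N by (auto simp: b_def field_simps)
  have "N ^ 1 \<le> N ^ 3" using N by (intro power_increasing) auto
  then have R: "(2::nat) ^ M \<ge> 2" using M N by simp
  let ?g = "\<lambda>p. max 0 (b - dist_int (gap x p * \<alpha>)) - b\<^sup>2 -
      (\<Sum>j\<in>{1..<2^M}. 2 * tri_coeff b j * cos (2 * pi * real j * (gap x p * \<alpha>)))"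
  have "tri_count x a N \<alpha> - real (card (index_pairs N)) * b\<^sup>2 - 2 * tri_fluct x a N M \<alpha> = (\<Sum>p\<in>index_pairs N. ?g p)"
  proof -
    have "2 * tri_fluct x a N M \<alpha> = 
      (\<Sum>p\<in>index_pairs N. \<Sum>j\<in>{1..<2^M}. 2 * tri_coeff b j * cos (2 * pi * real j * (gap x p * \<alpha>)))"
      unfolding tri_fluct_def b_def by (subst sum.swap) (simp only: sum_distrib_left mult.assoc)
    then show ?thesis by (simp add: sum_subtractf tri_count_def b_def)
  qed
  then have "\<bar>tri_count x a N \<alpha> - real (card (index_pairs N)) * b\<^sup>2 - 2 * tri_fluct x a N M \<alpha>\<bar> \<le> (\<Sum>p\<in>index_pairs N. \<bar>?g p\<bar>)"
    by (simp only: sum_abs)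
  also have "\<dots> \<le> (\<Sum>p\<in>index_pairs N. 4 / real (2 ^ M))"
    by (intro sum_mono triangle_partial_sum_error b R)
  also have "\<dots> \<le> (real N)\<^sup>2 * (4 / (real N) ^ 3)"
  proof -
    have "real (card (index_pairs N)) \<le> (real N)\<^sup>2"
      using card_index_pairs_le[of N] by (simp flip: of_nat_power)
    moreover have "real (N ^ 3) \<le> real (2 ^ M)" using M by (simp only: of_nat_le_iff)
    then have "4 / real (2 ^ M) \<le> 4 / (real N) ^ 3" using N by (intro divide_left_mono) auto
    ultimately have "real (card (index_pairs N)) * (4 / real (2 ^ M)) \<le> (real N)\<^sup>2 * (4 / (real N) ^ 3)"
      by (intro mult_mono) auto
    then show ?thesis by simp
  qed
  also have "\<dots> = 4 / real N" using N by (simp add: power2_eq_square power3_eq_cube)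
  finally have *: "\<bar>tri_count x a N \<alpha> - real (card (index_pairs N)) * b\<^sup>2 - 2 * tri_fluct x a N M \<alpha>\<bar> \<le> 4 / real N" .
  have "2 * (real (card (index_pairs N)) * b\<^sup>2) = a\<^sup>2 * (1 - 1 / real N)"
    using N unfolding card_index_pairs b_def by (simp add: field_simps power2_eq_square)
  then have "2 * tri_count x a N \<alpha> - a\<^sup>2 * (1 - 1 / real N) - 4 * tri_fluct x a N M \<alpha> = 
     2 * (tri_count x a N \<alpha> - real (card (index_pairs N)) * b\<^sup>2 - 2 * tri_fluct x a N M \<alpha>)"
    by simp
  then show ?thesis using * by (simp only: abs_mult abs_numeral) simp
qed

text \<open>By monotone convergence the sum of all f k has finite integral, hence is finite almost
  everywhere, and its terms tend to 0 there.\<close>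

lemma AE_tendsto_0_of_summable_integrals:
  fixes f :: "nat \<Rightarrow> 'a \<Rightarrow> real"
  assumes int: "\<And>k. integrable M (f k)" and nonneg: "\<And>k \<alpha>. f k \<alpha> \<ge> 0"
    and summ: "summable (\<lambda>k. \<integral>\<alpha>. f k \<alpha> \<partial>M)"
  shows "AE \<alpha> in M. (\<lambda>k. f k \<alpha>) \<longlonglongrightarrow> 0"
proof -
  have meas: "(\<lambda>\<alpha>. ennreal (f k \<alpha>)) \<in> borel_measurable M" for k
    using borel_measurable_integrable[OF int] by measurable
  have "(\<integral>\<^sup>+\<alpha>. (\<Sum>k. ennreal (f k \<alpha>)) \<partial>M) = (\<Sum>k. \<integral>\<^sup>+\<alpha>. ennreal (f k \<alpha>) \<partial>M)"
    by (rule nn_integral_suminf[OF meas])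
  also have "\<dots> = (\<Sum>k. ennreal (\<integral>\<alpha>. f k \<alpha> \<partial>M))"
    by (simp only: nn_integral_eq_integral[OF int AE_I2[OF nonneg]])
  also have "\<dots> \<noteq> \<infinity>"
    unfolding infinity_ennreal_def
    by (rule ennreal_suminf_neq_top[OF summ]) (simp only: Bochner_Integration.integral_nonneg[OF nonneg])
  finally have "AE \<alpha> in M. (\<Sum>k. ennreal (f k \<alpha>)) \<noteq> \<infinity>"
    using meas by (intro nn_integral_PInf_AE) auto
  then show ?thesis
  proof eventually_elim
    case (elim \<alpha>)
    then have "summable (\<lambda>k. f k \<alpha>)" using nonneg by (intro summable_suminf_not_top) auto
    then show ?case by (rule summable_LIMSEQ_zero)
  qed
qed

text \<open>The normal density vanishes nowhere, so Gaussian null sets are Lebesgue null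
  sets.\<close>

lemma AE_lebesgue_of_std_normal:
  assumes "AE \<alpha> in std_normal_distribution. P \<alpha>"
  shows "AE \<alpha> in lebesgue. P \<alpha>"
proof -
  have "AE \<alpha> in lborel. 0 < ennreal (std_normal_density \<alpha>) \<longrightarrow> P \<alpha>"
    using assms by (subst (asm) AE_density) auto
  then have "AE \<alpha> in lborel. P \<alpha>" by eventually_elim (simp add: normal_density_pos)
  then show ?thesis by (rule AE_completion)
qed

lemma tri_count_tendsto_AE:
  fixes x :: "nat \<Rightarrow> real"
  assumes gap: "\<exists>c>0. \<forall>n\<ge>1. x (n + 1) - x n \<ge> c"
    and en: "\<exists>\<delta>>0. \<forall>\<eta>>0. \<exists>C>0. \<forall>\<^sub>F N in sequentially. \<forall>\<gamma>\<in>{0<..1}.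
           real (energy x N \<gamma>) \<le> C * (real N powr (2 + \<eta>) + \<gamma> * real N powr (3 - \<delta>))"
  shows "\<exists>q\<ge>1. \<forall>a\<ge>0. AE \<alpha> in lebesgue. (\<lambda>k. 2 * tri_count x a (k ^ q) \<alpha>) \<longlonglongrightarrow> a\<^sup>2"
proof -
  obtain \<kappa> where \<kappa>: "\<kappa> > 0" and var: "\<And>a. \<exists>C. \<forall>\<^sub>F N in sequentially. \<forall>M. 2 ^ M \<le> 2 * N ^ 3 \<longrightarrow>
     (\<integral>\<alpha>. (tri_fluct x a N M \<alpha>)\<^sup>2 \<partial>std_normal_distribution) \<le> C * real N powr (- \<kappa>)"
    using tri_fluct_variance[OF gap en] by blast
  \<comment> \<open>With q \<kappa> >= 2 the variance at N = k^q is O(k^-2), hence summable.\<close>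
  define q where "q = nat \<lceil>2 / \<kappa>\<rceil> + 1"
  have q: "q \<ge> 1" "real q * \<kappa> \<ge> 2"
  proof -
    show "q \<ge> 1" by (simp add: q_def)
    have "2 / \<kappa> \<le> real q" unfolding q_def by linarith
    then show "real q * \<kappa> \<ge> 2" using \<kappa> by (simp add: field_simps)
  qed
  have Nlim: "filterlim (\<lambda>k. k ^ q) sequentially sequentially"
  proof (rule filterlim_at_top_mono[OF filterlim_ident])
    show "\<forall>\<^sub>F k in sequentially. k \<le> k ^ q"
      using eventually_ge_at_top[of 1] by eventually_elim (use q(1) in \<open>auto intro: self_le_power\<close>)
  qed
  \<comment> \<open>The lower bound on 2^M controls the truncation error, the upper bound the range
    of the divisor bound and the number of blocks.\<close>
  have "\<forall>N::nat. \<exists>M. N \<ge> 1 \<longrightarrow> N ^ 3 \<le> 2 ^ M \<and> 2 ^ M \<le> 2 * N ^ 3"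
  proof (intro allI)
    fix N :: nat
    show "\<exists>M. N \<ge> 1 \<longrightarrow> N ^ 3 \<le> 2 ^ M \<and> 2 ^ M \<le> 2 * N ^ 3"
    proof (cases "N \<ge> 1")
      case True
      then obtain n where "2 ^ n \<le> N ^ 3" "N ^ 3 < 2 ^ (n + 1)"
        using ex_power_ivl1[of 2 "N ^ 3"] by auto
      then show ?thesis by (intro exI[of _ "n + 1"]) auto
    qed auto
  qed
  then obtain M where M: "\<And>N::nat. N \<ge> 1 \<Longrightarrow> N ^ 3 \<le> 2 ^ M N" "\<And>N::nat. N \<ge> 1 \<Longrightarrow> 2 ^ M N \<le> 2 * N ^ 3"
    by metis
  have "AE \<alpha> in lebesgue. (\<lambda>k. 2 * tri_count x a (k ^ q) \<alpha>) \<longlonglongrightarrow> a\<^sup>2" if a: "a \<ge> 0" for a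
  proof -
    define f where "f k \<alpha> = (tri_fluct x a (k ^ q) (M (k ^ q)) \<alpha>)\<^sup>2" for k \<alpha>
    obtain C where C: "\<forall>\<^sub>F N in sequentially. \<forall>M. 2 ^ M \<le> 2 * N ^ 3 \<longrightarrow>
       (\<integral>\<alpha>. (tri_fluct x a N M \<alpha>)\<^sup>2 \<partial>std_normal_distribution) \<le> C * real N powr (- \<kappa>)"
      using var by blast
    have "\<forall>\<^sub>F k in sequentially. norm (\<integral>\<alpha>. f k \<alpha> \<partial>std_normal_distribution) \<le> \<bar>C\<bar> * (1 / real k ^ 2)"
      using eventually_compose_filterlim[OF C Nlim]
        eventually_ge_at_top[of 1]
    proof eventually_elim
      case (elim k)
      have "real (k ^ q) powr (- \<kappa>) = real k powr (- (real q * \<kappa>))"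
      proof -
        have "real (k ^ q) = real k powr real q" using elim by (simp add: powr_realpow)
        then show ?thesis by (simp only: powr_powr mult_minus_right)
      qed
      also have "\<dots> \<le> real k powr (- 2)" using elim q by (intro powr_mono) auto
      also have "\<dots> = 1 / real k ^ 2" using elim by (simp add: powr_minus divide_inverse)
      finally have le: "real (k ^ q) powr (- \<kappa>) \<le> 1 / real k ^ 2" .
      have "k ^ q \<ge> 1" using elim by simp
      then have "(\<integral>\<alpha>. f k \<alpha> \<partial>std_normal_distribution) \<le> C * real (k ^ q) powr (- \<kappa>)"
        using elim(1) M(2)[of "k ^ q"] unfolding f_def by blast
      also have "\<dots> \<le> \<bar>C\<bar> * real (k ^ q) powr (- \<kappa>)" by (intro mult_right_mono) auto
      also have "\<dots> \<le> \<bar>C\<bar> * (1 / real k ^ 2)" by (intro mult_left_mono le) auto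
      finally have up: "(\<integral>\<alpha>. f k \<alpha> \<partial>std_normal_distribution) \<le> \<bar>C\<bar> * (1 / real k ^ 2)" .
      have "0 \<le> (\<integral>\<alpha>. f k \<alpha> \<partial>std_normal_distribution)"
        by (rule Bochner_Integration.integral_nonneg) (simp add: f_def)
      then show ?case using up by (simp only: real_norm_def abs_of_nonneg)
    qed
    moreover have "summable (\<lambda>k. \<bar>C\<bar> * (1 / real k ^ 2))"
      using inverse_power_summable[of 2, where 'a = real] by (intro summable_mult) (simp add: divide_inverse)
    ultimately have "summable (\<lambda>k. \<integral>\<alpha>. f k \<alpha> \<partial>std_normal_distribution)"
      by (rule summable_comparison_test_ev)
    then have "AE \<alpha> in std_normal_distribution. (\<lambda>k. f k \<alpha>) \<longlonglongrightarrow> 0"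
      by (intro AE_tendsto_0_of_summable_integrals)
         (auto simp: f_def integrable_tri_fluct_square)
    then have "AE \<alpha> in lebesgue. (\<lambda>k. f k \<alpha>) \<longlonglongrightarrow> 0" by (rule AE_lebesgue_of_std_normal)
    then show ?thesis
    proof eventually_elim
      case (elim \<alpha>)
      define g where "g k = tri_fluct x a (k ^ q) (M (k ^ q)) \<alpha>" for k
      have "(\<lambda>k. sqrt (f k \<alpha>)) \<longlonglongrightarrow> sqrt 0" by (intro tendsto_real_sqrt elim)
      then have "(\<lambda>k. \<bar>g k\<bar>) \<longlonglongrightarrow> 0" by (simp add: f_def g_def)
      then have g: "g \<longlonglongrightarrow> 0" by (rule tendsto_rabs_zero_cancel)
      have inv: "(\<lambda>k. 1 / real (k ^ q)) \<longlonglongrightarrow> 0"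
        using filterlim_compose[OF lim_1_over_n Nlim] by simp
      have "(\<lambda>k. 2 * tri_count x a (k ^ q) \<alpha> - a\<^sup>2 * (1 - 1 / real (k ^ q)) - 4 * g k) \<longlonglongrightarrow> 0"
      proof (rule Lim_null_comparison)
        have "\<forall>\<^sub>F N in sequentially. N \<ge> 2 \<and> 2 * a \<le> real N"
          using eventually_ge_at_top[of "max 2 (nat \<lceil>2 * a\<rceil>)"] by eventually_elim linarith
        from eventually_compose_filterlim[OF this Nlim]
        show "\<forall>\<^sub>F k in sequentially. norm (2 * tri_count x a (k ^ q) \<alpha> - a\<^sup>2 * (1 - 1 / real (k ^ q)) - 4 * g k)
            \<le> 8 * (1 / real (k ^ q))"
        proof eventually_elim
          case (elim k)
          have "k ^ q \<ge> 1" using elim by linarith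
          then show ?case
            using tri_count_approx[OF a conjunct2[OF elim] M(1) conjunct1[OF elim], of x \<alpha>]
            unfolding g_def real_norm_def by (simp only: times_divide_eq_right mult_1_right \<open>1 \<le> k ^ q\<close>)
        qed
        show "(\<lambda>k. 8 * (1 / real (k ^ q))) \<longlonglongrightarrow> 0"
          using tendsto_mult_left[OF inv, of 8] by simp
      qed
      from tendsto_add[OF this tendsto_add[OF tendsto_mult[OF tendsto_const tendsto_diff[OF tendsto_const inv]] tendsto_mult[OF tendsto_const g]], of "a\<^sup>2" 1 4]
      show ?case by simp
    qed
  qed
  then show ?thesis using q(1) by blast
qed

section \<open>From triangles to pair counts, and from the powers k^q to all N\<close>

lemma dist_int_minus: "dist_int (- t) = dist_int t"
proof -
  have le: "dist_int (- t) \<le> dist_int t" for t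
    using round_diff_minimal[of "- t" "- round t"] by (simp add: dist_int_def)
  from le[of t] le[of "- t"] show ?thesis by simp
qed

lemma periodic_indicator_eq: "periodic_indicator r t = (if dist_int t \<le> r then 1 else 0)"
  by (auto simp: periodic_indicator_def dist_int_def indicator_def)

definition pair_count :: "(nat \<Rightarrow> real) \<Rightarrow> real \<Rightarrow> nat \<Rightarrow> real \<Rightarrow> nat" where
  "pair_count x s N \<alpha> = card {p \<in> index_pairs N. dist_int (gap x p * \<alpha>) \<le> s / real N}"

lemma sum_periodic_indicator_eq:
  "(\<Sum>(m, n) \<in> {(m, n). m \<in> {1..N} \<and> n \<in> {1..N} \<and> m \<noteq> n}.
      periodic_indicator (s / real N) (x n * \<alpha> - x m * \<alpha>)) = 2 * real (pair_count x s N \<alpha>)"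
proof -
  let ?h = "\<lambda>(m, n). periodic_indicator (s / real N) (x n * \<alpha> - x m * \<alpha>)"
  have sym: "periodic_indicator (s / real N) (x m * \<alpha> - x n * \<alpha>) =
      periodic_indicator (s / real N) (x n * \<alpha> - x m * \<alpha>)" for m n
    using dist_int_minus[of "x n * \<alpha> - x m * \<alpha>"] by (simp add: periodic_indicator_eq)
  have "{(m, n). m \<in> {1..N} \<and> n \<in> {1..N} \<and> m \<noteq> n} = index_pairs N \<union> prod.swap ` index_pairs N"
    by (auto simp: index_pairs_def image_iff)
  moreover have "index_pairs N \<inter> prod.swap ` index_pairs N = {}" by (auto simp: index_pairs_def)
  ultimately have "sum ?h {(m, n). m \<in> {1..N} \<and> n \<in> {1..N} \<and> m \<noteq> n} =
      sum ?h (index_pairs N) + sum ?h (prod.swap ` index_pairs N)"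
    by (simp add: sum.union_disjoint)
  also have "sum ?h (prod.swap ` index_pairs N) = sum ?h (index_pairs N)"
    by (subst sum.reindex) (auto simp: sym intro!: sum.cong)
  also have "sum ?h (index_pairs N) =
      (\<Sum>p\<in>index_pairs N. if dist_int (gap x p * \<alpha>) \<le> s / real N then 1 else 0)"
    by (intro sum.cong) (auto simp: periodic_indicator_eq gap_def left_diff_distrib)
  also have "\<dots> = real (pair_count x s N \<alpha>)"
    by (simp add: pair_count_def sum.If_cases Int_def)
  finally show ?thesis by simp
qed

lemma pair_count_mono:
  assumes "N \<le> N'" "s / real N \<le> s' / real N'"
  shows "pair_count x s N \<alpha> \<le> pair_count x s' N' \<alpha>"
  unfolding pair_count_def using assms
  by (intro card_mono) (auto simp: index_pairs_def intro: finite_subset[OF _ finite_index_pairs[of N']])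

text \<open>A difference of two triangles is a trapezoid: it equals (b - a)/N up to distance a/N and
  vanishes beyond b/N. Divided by its height it majorises the indicator when s <= a, and minorises
  it when b <= s, as in \<open>pair_count_ge_tri\<close>.\<close>

lemma pair_count_le_tri:
  assumes ab: "0 \<le> s" "s \<le> a" "a < b" and N: "N \<ge> 1"
  shows "real (pair_count x s N \<alpha>) / real N \<le> (tri_count x b N \<alpha> - tri_count x a N \<alpha>) / (b - a)"
proof -
  define w where "w = (b - a) / real N"
  have w: "w > 0" using ab N by (simp add: w_def)
  have "w * real (pair_count x s N \<alpha>) = (\<Sum>p\<in>index_pairs N. if dist_int (gap x p * \<alpha>) \<le> s / real N then w else 0)"
    by (simp add: pair_count_def sum.If_cases Int_def)
  also have "\<dots> \<le> (\<Sum>p\<in>index_pairs N. max 0 (b / real N - dist_int (gap x p * \<alpha>)) - max 0 (a / real N - dist_int (gap x p * \<alpha>)))"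
  proof (rule sum_mono)
    fix p
    have "s / real N \<le> a / real N" "a / real N \<le> b / real N"
      using ab by (auto intro!: divide_right_mono)
    then show "(if dist_int (gap x p * \<alpha>) \<le> s / real N then w else 0) \<le> 
      max 0 (b / real N - dist_int (gap x p * \<alpha>)) - max 0 (a / real N - dist_int (gap x p * \<alpha>))"
      by (auto simp: w_def diff_divide_distrib max_def)
  qed
  also have "\<dots> = tri_count x b N \<alpha> - tri_count x a N \<alpha>"
    by (simp add: tri_count_def sum_subtractf)
  finally show ?thesis using ab N by (simp add: w_def field_simps)
qed

lemma pair_count_ge_tri:
  assumes ab: "a < b" "b \<le> s" and N: "N \<ge> 1"
  shows "(tri_count x b N \<alpha> - tri_count x a N \<alpha>) / (b - a) \<le> real (pair_count x s N \<alpha>) / real N"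
proof -
  define w where "w = (b - a) / real N"
  have w: "w > 0" using ab N by (simp add: w_def)
  have "tri_count x b N \<alpha> - tri_count x a N \<alpha> = 
    (\<Sum>p\<in>index_pairs N. max 0 (b / real N - dist_int (gap x p * \<alpha>)) - max 0 (a / real N - dist_int (gap x p * \<alpha>)))"
    by (simp add: tri_count_def sum_subtractf)
  also have "\<dots> \<le> (\<Sum>p\<in>index_pairs N. if dist_int (gap x p * \<alpha>) \<le> s / real N then w else 0)"
  proof (rule sum_mono)
    fix p
    have "b / real N \<le> s / real N" "a / real N \<le> b / real N"
      using ab by (auto intro!: divide_right_mono)
    then show "max 0 (b / real N - dist_int (gap x p * \<alpha>)) - max 0 (a / real N - dist_int (gap x p * \<alpha>))
      \<le> (if dist_int (gap x p * \<alpha>) \<le> s / real N then w else 0)"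
      by (auto simp: w_def diff_divide_distrib max_def)
  qed
  also have "\<dots> = w * real (pair_count x s N \<alpha>)"
    by (simp add: pair_count_def sum.If_cases Int_def)
  finally show ?thesis using ab N by (simp add: w_def field_simps)
qed

text \<open>The trapezoid statistics tend to (b^2 - a^2)/(2 (b - a)) = (a + b)/2, and a, b can be
  placed on either side of s as close to it as desired. Only rational widths are assumed, so that
  countably many exceptional null sets suffice, while s is any real.\<close>

lemma pair_count_tendsto_subseq:
  assumes tri: "\<And>a. a \<in> \<rat> \<Longrightarrow> a \<ge> 0 \<Longrightarrow> (\<lambda>k. 2 * tri_count x a (\<nu> k) \<alpha>) \<longlonglongrightarrow> a\<^sup>2"
    and \<nu>: "\<forall>\<^sub>F k in sequentially. \<nu> k \<ge> 1" and s: "s \<ge> 0"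
  shows "(\<lambda>k. real (pair_count x s (\<nu> k) \<alpha>) / real (\<nu> k)) \<longlonglongrightarrow> s"
proof -
  have trapezoid: "(\<lambda>k. (tri_count x b (\<nu> k) \<alpha> - tri_count x a (\<nu> k) \<alpha>) / (b - a)) \<longlonglongrightarrow> (a + b) / 2"
    if "a \<in> \<rat>" "b \<in> \<rat>" "0 \<le> a" "a < b" for a b
  proof -
    have "(\<lambda>k. (2 * tri_count x b (\<nu> k) \<alpha> - 2 * tri_count x a (\<nu> k) \<alpha>) / (2 * (b - a))) \<longlonglongrightarrow> (b\<^sup>2 - a\<^sup>2) / (2 * (b - a))"
      using that by (intro tendsto_intros tri) auto
    moreover have "(b\<^sup>2 - a\<^sup>2) / (2 * (b - a)) = (a + b) / 2"
      using that by (simp add: field_simps power2_eq_square)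
    moreover have "(2 * u - 2 * v) / (2 * (b - a)) = (u - v) / (b - a)" for u v
      using that by (simp add: field_simps)
    ultimately show ?thesis by (simp only:)
  qed
  show ?thesis
  proof (rule order_tendstoI)
    fix y assume y: "s < y"
    obtain a where a: "a \<in> \<rat>" "s < a" "a < y" using Rats_dense_in_real[OF y] by blast
    obtain b where b: "b \<in> \<rat>" "a < b" "b < y" using Rats_dense_in_real[OF a(3)] by blast
    have "(a + b) / 2 < y" using a b by simp
    then have "\<forall>\<^sub>F k in sequentially. (tri_count x b (\<nu> k) \<alpha> - tri_count x a (\<nu> k) \<alpha>) / (b - a) < y"
      using a b s by (intro order_tendstoD(2)[OF trapezoid]) auto
    with \<nu> show "\<forall>\<^sub>F k in sequentially. real (pair_count x s (\<nu> k) \<alpha>) / real (\<nu> k) < y"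
    proof eventually_elim
      case (elim k)
      then show ?case using pair_count_le_tri[of s a b "\<nu> k" x \<alpha>] a b s by linarith
    qed
  next
    fix y assume y: "y < s"
    show "\<forall>\<^sub>F k in sequentially. y < real (pair_count x s (\<nu> k) \<alpha>) / real (\<nu> k)"
    proof (cases "y < 0")
      \<comment> \<open>Negative y are set aside because the rationals chosen in the other case must
        be nonnegative.\<close>
      case True
      then show ?thesis by (intro always_eventually allI) (rule less_le_trans, auto)
    next
      case False
      obtain a where a: "a \<in> \<rat>" "y < a" "a < s" using Rats_dense_in_real[OF y] by blast
      obtain b where b: "b \<in> \<rat>" "a < b" "b < s" using Rats_dense_in_real[OF a(3)] by blast
      have "y < (a + b) / 2" using a b by simp
      then have "\<forall>\<^sub>F k in sequentially. y < (tri_count x b (\<nu> k) \<alpha> - tri_count x a (\<nu> k) \<alpha>) / (b - a)"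
        using a b False by (intro order_tendstoD(1)[OF trapezoid]) auto
      with \<nu> show ?thesis
      proof eventually_elim
        case (elim k)
        then show ?case using pair_count_ge_tri[of a b s "\<nu> k" x \<alpha>] a b by linarith
      qed
    qed
  qed
qed

text \<open>For a fixed absolute width the count grows with N. Moving from N to r' or r changes both
  the width s/N and the normalisation 1/N by a factor of at most \<open>l\<close>.\<close>

lemma pair_count_sandwich:
  fixes l :: real
  assumes l: "l > 1" and s: "s \<ge> 0" and r: "1 \<le> r" "r \<le> N" "N \<le> r'" and ratio: "real r' \<le> l * real r"
  shows "real (pair_count x s N \<alpha>) / real N \<le> l * (real (pair_count x (l * s) r' \<alpha>) / real r')"
    and "real (pair_count x (s / l) r \<alpha>) / real r / l \<le> real (pair_count x s N \<alpha>) / real N"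
proof -
  have pos: "real r > 0" "real N > 0" "real r' > 0" using r by auto
  have le: "real r \<le> real N" "real N \<le> real r'" "real r' \<le> l * real N" "real N \<le> l * real r"
  proof -
    show "real r \<le> real N" "real N \<le> real r'" using r by auto
    then show "real N \<le> l * real r" using ratio by linarith
    have "l * real r \<le> l * real N" using r l by simp
    then show "real r' \<le> l * real N" using ratio by linarith
  qed
  have "s * real r' \<le> s * (l * real N)" by (rule mult_left_mono[OF le(3) s])
  then have "s / real N \<le> l * s / real r'" using pos by (simp add: field_simps)
  from pair_count_mono[OF r(3) this, of x \<alpha>]
  have "real (pair_count x s N \<alpha>) \<le> real (pair_count x (l * s) r' \<alpha>)" by (simp only: of_nat_le_iff)
  then have "real (pair_count x s N \<alpha>) / real N \<le> real (pair_count x (l * s) r' \<alpha>) / (real r' / l)"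
    using pos l le(3) by (intro frac_le) (auto simp: field_simps)
  then show "real (pair_count x s N \<alpha>) / real N \<le> l * (real (pair_count x (l * s) r' \<alpha>) / real r')"
    by (simp add: mult.commute)
  have "s * real N \<le> s * (l * real r)" by (rule mult_left_mono[OF le(4) s])
  then have "s / l / real r \<le> s / real N" using pos l by (simp add: field_simps)
  from pair_count_mono[OF r(2) this, of x \<alpha>]
  have "real (pair_count x (s / l) r \<alpha>) \<le> real (pair_count x s N \<alpha>)" by (simp only: of_nat_le_iff)
  then have "real (pair_count x (s / l) r \<alpha>) / (real r * l) \<le> real (pair_count x s N \<alpha>) / real N"
    using pos l le(4) by (intro frac_le) (auto simp: mult.commute)
  then show "real (pair_count x (s / l) r \<alpha>) / real r / l \<le> real (pair_count x s N \<alpha>) / real N"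
    by simp
qed

lemma ex_power_interval:
  fixes N K q :: nat
  assumes "q \<ge> 1" "K ^ q \<le> N"
  shows "\<exists>k\<ge>K. k ^ q \<le> N \<and> N < (k + 1) ^ q"
proof -
  let ?P = "\<lambda>k. k ^ q \<le> N"
  have bd: "k \<le> N" if "?P k" for k
  proof (cases "k = 0")
    case False
    then have "k \<le> k ^ q" using assms by (intro self_le_power) auto
    then show ?thesis using that by linarith
  qed simp
  have ex: "\<exists>k. ?P k" using assms by blast
  define k where "k = Greatest ?P"
  have "?P k" unfolding k_def using GreatestI_ex_nat[of ?P, OF ex bd] by simp
  moreover have "K \<le> k" unfolding k_def using Greatest_le_nat[of ?P, OF assms(2)] bd by blast
  moreover have "\<not> ?P (k + 1)"
  proof
    assume "?P (k + 1)"
    then have "k + 1 \<le> k" unfolding k_def using Greatest_le_nat[of ?P "Greatest ?P + 1"] bd by blast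
    then show False by simp
  qed
  ultimately show ?thesis by (auto simp: not_le)
qed

text \<open>One parameter l > 1 bounds the ratio of consecutive powers and, through l - 1, the error
  along the subsequence at the parameters l s and s/l. Both resulting bounds for large N tend to s
  as l decreases to 1.\<close>

lemma pair_count_tendsto:
  assumes tri: "\<And>a. a \<in> \<rat> \<Longrightarrow> a \<ge> 0 \<Longrightarrow> (\<lambda>k. 2 * tri_count x a (k ^ q) \<alpha>) \<longlonglongrightarrow> a\<^sup>2"
    and q: "q \<ge> 1" and s: "s \<ge> 0"
  shows "(\<lambda>N. real (pair_count x s N \<alpha>) / real N) \<longlonglongrightarrow> s"
proof -
  define R where "R s N = real (pair_count x s N \<alpha>) / real N" for s N
  have R: "(\<lambda>k. R t (k ^ q)) \<longlonglongrightarrow> t" if "t \<ge> 0" for t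
    unfolding R_def
  proof (rule pair_count_tendsto_subseq[OF tri _ that])
    show "\<forall>\<^sub>F k::nat in sequentially. k ^ q \<ge> 1"
      using eventually_ge_at_top[of 1] by eventually_elim simp
  qed
  have ratio: "(\<lambda>k. (real (k + 1) / real k) ^ q) \<longlonglongrightarrow> 1 ^ q"
  proof (rule tendsto_power)
    show "(\<lambda>k. real (k + 1) / real k) \<longlonglongrightarrow> 1" by real_asymp
  qed
  have bounds: "\<forall>\<^sub>F N in sequentially. R s N < l * (l * s + (l - 1)) \<and> (s / l - (l - 1)) / l < R s N"
    if l: "l > 1" for l
  proof -
    have "\<forall>\<^sub>F k in sequentially. R (l * s) (k ^ q) < l * s + (l - 1)"
      using l s by (intro order_tendstoD(2)[OF R]) auto
    moreover have "\<forall>\<^sub>F k in sequentially. s / l - (l - 1) < R (s / l) (k ^ q)"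
      using l s by (intro order_tendstoD(1)[OF R]) auto
    moreover have "\<forall>\<^sub>F k in sequentially. (real (k + 1) / real k) ^ q < l"
      using l by (intro order_tendstoD(2)[OF ratio]) simp
    ultimately have "\<forall>\<^sub>F k in sequentially. R (l * s) (k ^ q) < l * s + (l - 1) \<and>
        s / l - (l - 1) < R (s / l) (k ^ q) \<and> (real (k + 1) / real k) ^ q < l"
      by eventually_elim blast
    then obtain K where K: "\<And>k. k \<ge> K \<Longrightarrow> R (l * s) (k ^ q) < l * s + (l - 1)"
      "\<And>k. k \<ge> K \<Longrightarrow> s / l - (l - 1) < R (s / l) (k ^ q)"
      "\<And>k. k \<ge> K \<Longrightarrow> (real (k + 1) / real k) ^ q < l"
      unfolding eventually_sequentially by blast
    show ?thesis
      using eventually_ge_at_top[of "(max 1 K) ^ q"]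
    proof eventually_elim
      case (elim N)
      obtain k where k: "k \<ge> max 1 K" "k ^ q \<le> N" "N < (k + 1) ^ q"
        using ex_power_interval[OF q elim] by blast
      have kK: "k \<ge> K" "k + 1 \<ge> K" "k \<ge> 1" using k(1) by auto
      have "real ((k + 1) ^ q) \<le> l * real (k ^ q)"
        using K(3)[OF kK(1)] kK(3) by (simp add: power_divide field_simps)
      note sw = pair_count_sandwich[OF l s _ k(2) less_imp_le[OF k(3)] this, of x \<alpha>, folded R_def]
      have k1: "1 \<le> k ^ q" using kK(3) by simp
      have "R s N \<le> l * R (l * s) ((k + 1) ^ q)" by (rule sw(1)[OF k1])
      also have "\<dots> < l * (l * s + (l - 1))"
        using K(1)[OF kK(2)] l by (intro mult_strict_left_mono) auto
      finally have 1: "R s N < l * (l * s + (l - 1))" .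
      have "(s / l - (l - 1)) / l < R (s / l) (k ^ q) / l"
        using K(2)[OF kK(1)] l by (intro divide_strict_right_mono) auto
      also have "\<dots> \<le> R s N" by (rule sw(2)[OF k1])
      finally show ?case using 1 by blast
    qed
  qed
  have up: "((\<lambda>l. l * (l * s + (l - 1))) \<longlongrightarrow> 1 * (1 * s + (1 - 1))) (at_right 1)"
    by (intro tendsto_intros)
  have lo: "((\<lambda>l. (s / l - (l - 1)) / l) \<longlongrightarrow> (s / 1 - (1 - 1)) / 1) (at_right 1)"
    by (intro tendsto_intros) auto
  have gt: "\<forall>\<^sub>F l in at_right 1. l > (1::real)" by (rule eventually_at_right_less)
  have "R s \<longlonglongrightarrow> s"
  proof (rule order_tendstoI)
    fix y assume "s < y"
    then have "\<forall>\<^sub>F l in at_right 1. l * (l * s + (l - 1)) < y"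
      by (intro order_tendstoD(2)[OF up]) simp
    with gt have "\<forall>\<^sub>F l in at_right 1. l > 1 \<and> l * (l * s + (l - 1)) < y"
      by eventually_elim blast
    then obtain l where l: "l > 1" "l * (l * s + (l - 1)) < y"
      using eventually_happens[of _ "at_right (1::real)"] by auto
    from bounds[OF l(1)] show "\<forall>\<^sub>F N in sequentially. R s N < y"
      by eventually_elim (use l(2) in linarith)
  next
    fix y assume "y < s"
    then have "\<forall>\<^sub>F l in at_right 1. y < (s / l - (l - 1)) / l"
      by (intro order_tendstoD(1)[OF lo]) simp
    with gt have "\<forall>\<^sub>F l in at_right 1. l > 1 \<and> y < (s / l - (l - 1)) / l"
      by eventually_elim blast
    then obtain l where l: "l > 1" "y < (s / l - (l - 1)) / l"
      using eventually_happens[of _ "at_right (1::real)"] by auto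
    from bounds[OF l(1)] show "\<forall>\<^sub>F N in sequentially. y < R s N"
      by eventually_elim (use l(2) in linarith)
  qed
  then show ?thesis by (simp only: R_def[abs_def])
qed

theorem theorem2:
  fixes x :: "nat \<Rightarrow> real"
  assumes "\<And>n. n \<ge> 1 \<Longrightarrow> x n > 0"
    and "\<exists>c>0. \<forall>n\<ge>1. x (n + 1) - x n \<ge> c"
    and "\<exists>\<delta>>0. \<forall>\<eta>>0. \<exists>C>0. \<forall>\<^sub>F N in sequentially. \<forall>\<gamma>\<in>{0<..1}.
           real (energy x N \<gamma>) \<le> C * (real N powr (2 + \<eta>) + \<gamma> * real N powr (3 - \<delta>))"
  shows "AE \<alpha> in lebesgue. poissonian_pair_correlation (\<lambda>n. x n * \<alpha>)"
proof -
  obtain q where q: "q \<ge> 1"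
    and tri: "\<And>a. a \<ge> 0 \<Longrightarrow> AE \<alpha> in lebesgue. (\<lambda>k. 2 * tri_count x a (k ^ q) \<alpha>) \<longlonglongrightarrow> a\<^sup>2"
    using tri_count_tendsto_AE[OF assms(2,3)] by blast
  \<comment> \<open>One null set must serve for all s at once, so the almost sure limits are merged
    over the countably many rational widths before s is chosen.\<close>
  have "AE \<alpha> in lebesgue. \<forall>a\<in>\<rat> \<inter> {0..}. (\<lambda>k. 2 * tri_count x a (k ^ q) \<alpha>) \<longlonglongrightarrow> a\<^sup>2"
    using tri by (intro AE_ball_countable') (auto intro: countable_Int1 countable_rat)
  then show ?thesis
  proof eventually_elim
    case (elim \<alpha>)
    have "(\<lambda>N. real (pair_count x s N \<alpha>) / real N) \<longlonglongrightarrow> s" if "s \<ge> 0" for s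
      using elim by (intro pair_count_tendsto[OF _ q that]) auto
    then have "(\<lambda>N. 2 * (real (pair_count x s N \<alpha>) / real N)) \<longlonglongrightarrow> 2 * s" if "s \<ge> 0" for s
      using that by (intro tendsto_mult_left) auto
    then show ?case
      unfolding poissonian_pair_correlation_def sum_periodic_indicator_eq by simp
  qed
qed

end
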